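(* Let $n\ge 2$, let $\mathcal{M}=\partial D\subset\mathbb{R}^n$ be the boundary of a bounded domain $D$ strictly starlike with respect to the origin, and let $\varphi:S^{n-1}\to\mathcal{M}$ be the homeomorphism which, for every ray $R$ from $0$, sends the point of $R\cap S^{n-1}$ to the point of $R\cap\mathcal{M}$. Then $$\mathrm{Lip}(\varphi^{-1})=\frac{1}{\mathrm{dist}(\mathcal{M},0)}=\limsup_{r\to 0}\ \sup_{z,\zeta\in S^{n-1},\,0<|z-\zeta|<r}\frac{|z-\zeta|}{|\varphi(z)-\varphi(\zeta)|}.$$ Moreover, $\varphi$ is bi-Lipschitz if and only if $D$ satisfies the $\alpha$-tangent condition for some $\alpha\in(0,\pi/2]$; and in that case, if $\alpha=\alpha(\mathcal{M})$ denotes the maximum of all such constants, then $$\mathrm{Lip}(\varphi)=\sup_{\zeta\in S^{n-1}}\ \limsup_{z\to\zeta}\frac{|\varphi(z)-\varphi(\zeta)|}{|z-\zeta|}$$ and $$\mathrm{Lip}(\varphi)=\operatorname*{ess\,sup}_{x\in\mathcal{M}}\frac{|x|}{\sin\alpha(x)}\in\left[\frac{r_{\min}}{\sin\alpha},\frac{r_{\max}}{\sin\alpha}\right],$$ where $r_{\min}=\min_{x\in\mathcal{M}}|x|$ and $r_{\max}=\max_{x\in\mathcal{M}}|x|$.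
   Context: $S^{n-1}$ is the unit sphere of $\mathbb{R}^n$; subsets of $\mathbb{R}^n$ carry the Euclidean metric. A bounded domain $D\subset\mathbb{R}^n$ is strictly starlike with respect to the point $a$ if each ray emanating from $a$ meets $\partial D$ at exactly one point (in particular $a\in D$). For a map $f$ between metric spaces, $\mathrm{Lip}(f)$ is the smallest $L$ with $d(f(x),f(y))\le L\,d(x,y)$ for all $x,y$ ($\infty$ if there is none); $f$ is bi-Lipschitz if it is a homeomorphism and, for some $L\ge1$, $d(x,y)/L\le d(f(x),f(y))\le L\,d(x,y)$ for all $x,y$. $\mathrm{dist}(\mathcal{M},0)=\inf_{x\in\mathcal{M}}|x|$. Tangent condition: for $D$ strictly starlike with respect to $0$ and $x,z\in\partial D$, $z\ne x$, let $\alpha(z,x)\in[0,\pi/2]$ be the acute angle which the segment $[z,x]$ makes with the ray from $0$ through $x$, i.e. $\cos\alpha(z,x)=\frac{|\langle z-x,x\rangle|}{|z-x||x|}$, and put $\alpha(x)=\liminf_{z\to x,\,z\in\partial D}\alpha(z,x)\in[0,\pi/2]$. For $\alpha\in(0,\pi/2]$, $D$ (and its boundary $\partial D$) satisfies the $\alpha$-tangent condition if $\alpha(x)\ge\alpha$ for every $x\in\partial D$. The essential supremum over $\mathcal{M}$ is with respect to $(n-1)$-dimensional Hausdorff (surface) measure. *)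

theory Defs
  imports "HOL-Analysis.Analysis" "HOL-Probability.Essential_Supremum"
begin

section \<open>Strictly starlike domains and the radial homeomorphism\<close>

definition ray :: "'a::real_vector \<Rightarrow> 'a \<Rightarrow> 'a set" where
  "ray a u = {a + t *\<^sub>R u | t. 0 \<le> t}"

definition strictly_starlike :: "'a::real_normed_vector \<Rightarrow> 'a set \<Rightarrow> bool" where
  "strictly_starlike a D \<longleftrightarrow> a \<in> D \<and> (\<forall>u\<in>sphere 0 1. \<exists>!x. x \<in> ray a u \<inter> frontier D)"

text \<open>The ray from \<open>0\<close> through \<open>u \<in> sphere 0 1\<close> meets the unit sphere exactly at \<open>u\<close>; the map is
  meaningful only on \<open>sphere 0 1\<close> and for \<open>D\<close> strictly starlike with respect to \<open>0\<close>.\<close>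

definition radial_map :: "'a::real_normed_vector set \<Rightarrow> 'a \<Rightarrow> 'a" where
  "radial_map D u = (THE x. x \<in> ray 0 u \<inter> frontier D)"

section \<open>Lipschitz constants and bi-Lipschitz maps\<close>

text \<open>The set of admissible constants is closed, so for nonempty \<open>X\<close> the infimum is the smallest
  constant, and it is \<open>\<infinity>\<close> if there is none.\<close>

definition Lip :: "'a::metric_space set \<Rightarrow> ('a \<Rightarrow> 'b::metric_space) \<Rightarrow> ereal" where
  "Lip X f = Inf (ereal ` {L. L-lipschitz_on X f})"

definition bi_lipschitz :: "'a::metric_space set \<Rightarrow> 'b::metric_space set \<Rightarrow> ('a \<Rightarrow> 'b) \<Rightarrow> bool" where
  "bi_lipschitz X Y f \<longleftrightarrow>
     (\<exists>g. homeomorphism X Y f g) \<and>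
     (\<exists>L\<ge>1. \<forall>x\<in>X. \<forall>y\<in>X. dist x y / L \<le> dist (f x) (f y) \<and> dist (f x) (f y) \<le> L * dist x y)"

section \<open>The tangent condition\<close>

definition segment_angle :: "'a::real_inner \<Rightarrow> 'a \<Rightarrow> real" where
  "segment_angle z x = arccos (\<bar>(z - x) \<bullet> x\<bar> / (norm (z - x) * norm x))"

text \<open>The lower limit is taken in \<open>ereal\<close>, where it always exists; it lies in \<open>[0, pi/2]\<close> whenever
  \<open>x\<close> is a limit point of \<open>M\<close>.\<close>

definition tangent_angle :: "'a::real_inner set \<Rightarrow> 'a \<Rightarrow> real" where
  "tangent_angle M x = real_of_ereal (Liminf (at x within M) (\<lambda>z. ereal (segment_angle z x)))"

definition tangent_condition :: "real \<Rightarrow> 'a::real_inner set \<Rightarrow> bool" where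
  "tangent_condition \<alpha> M \<longleftrightarrow> 0 < \<alpha> \<and> \<alpha> \<le> pi / 2 \<and> (\<forall>x\<in>M. \<alpha> \<le> tangent_angle M x)"

section \<open>Hausdorff measure\<close>

text \<open>Normalised so that the \<open>d\<close>-dimensional measure agrees with Lebesgue measure in dimension \<open>d\<close>.
  The empty set is treated separately so that it costs nothing even for \<open>d = 0\<close>. Covering sets
  have to be bounded explicitly, since \<^const>\<open>diameter\<close> is an unspecified real number on unbounded
  sets.\<close>

definition hausdorff_cost :: "nat \<Rightarrow> 'a::metric_space set \<Rightarrow> ennreal" where
  "hausdorff_cost d U = (if U = {} then 0 else ennreal (unit_ball_vol (real d) * (diameter U / 2) ^ d))"

definition hausdorff_cover :: "real \<Rightarrow> 'a::metric_space set \<Rightarrow> (nat \<Rightarrow> 'a set) \<Rightarrow> bool" where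
  "hausdorff_cover \<delta> A U \<longleftrightarrow> A \<subseteq> (\<Union>i. U i) \<and> (\<forall>i. bounded (U i) \<and> diameter (U i) \<le> \<delta>)"

definition hausdorff_premeasure :: "nat \<Rightarrow> real \<Rightarrow> 'a::metric_space set \<Rightarrow> ennreal" where
  "hausdorff_premeasure d \<delta> A = (INF U\<in>{U. hausdorff_cover \<delta> A U}. \<Sum>i. hausdorff_cost d (U i))"

definition hausdorff_outer :: "nat \<Rightarrow> 'a::metric_space set \<Rightarrow> ennreal" where
  "hausdorff_outer d A = (SUP \<delta>\<in>{0<..}. hausdorff_premeasure d \<delta> A)"

definition hausdorff_measure :: "nat \<Rightarrow> 'a::metric_space measure" where
  "hausdorff_measure d = measure_of UNIV (sets borel) (hausdorff_outer d)"

text \<open>\<^const>\<open>measure_of\<close> silently returns the zero measure when its argument is not countably additive.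
  The remainder of the theory excludes this (Caratheodory's criterion for metric outer measures);
  the outcome is \<open>emeasure_hausdorff_measure\<close>.\<close>

lemma metric_outer_measure_space:
  fixes m :: "'a::metric_space set \<Rightarrow> ennreal"
  assumes empty: "m {} = 0"
    and mono: "\<And>A B. A \<subseteq> B \<Longrightarrow> m A \<le> m B"
    and csub: "\<And>A::nat \<Rightarrow> 'a set. m (\<Union>i. A i) \<le> (\<Sum>i. m (A i))"
    and sep: "\<And>A B e. 0 < e \<Longrightarrow> (\<And>x y. x \<in> A \<Longrightarrow> y \<in> B \<Longrightarrow> e \<le> dist x y) \<Longrightarrow> m A + m B \<le> m (A \<union> B)"
  shows "measure_space UNIV (sets (borel :: 'a measure)) m"
proof -
  interpret P: sigma_algebra "UNIV :: 'a set" "Pow UNIV"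
    by (rule sigma_algebra_Pow)
  have oms: "outer_measure_space (Pow UNIV) m"
    using empty mono csub
    by (auto simp: outer_measure_space_def positive_def increasing_def countably_subadditive_def)
  have sub2: "m (A \<union> B) \<le> m A + m B" for A B
  proof -
    have "m (\<Union>i. binaryset A B i) \<le> (\<Sum>i. m (binaryset A B i))"
      by (rule csub)
    also have "\<dots> = m A + m B"
      by (rule suminf_binaryset_eq[of m A B, OF empty])
    finally show ?thesis
      by (simp add: UN_binaryset_eq)
  qed
  have closed_in: "C \<in> lambda_system UNIV (Pow UNIV) m" if C: "closed C" for C :: "'a set"
  proof (cases "C = {}")
    case True
    then show ?thesis
      using P.lambda_system_empty oms by (auto simp: outer_measure_space_def)
  next
    case ne: False
    have le: "m (A \<inter> C) + m (A - C) \<le> m A" for A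
    proof (cases "m A = top")
      case False
      define E where "E k = {x\<in>A. 1 / real (Suc k) \<le> infdist x C}" for k
      define T where "T k = E (Suc k) - E k" for k
      have T_sum: "(\<Sum>k<N. m (T (2 * k + c))) \<le> m A" for N c
      proof -
        have "(\<Sum>k<N. m (T (2 * k + c))) \<le> m (\<Union>k<N. T (2 * k + c))"
        proof (induction N)
          case 0
          then show ?case by simp
        next
          case (Suc N)
          have e: "0 < 1 / real (2 * N + c) - 1 / real (2 * N + c + 1)" if "N > 0"
            using that by (simp add: frac_less2)
          have "m (\<Union>k<N. T (2 * k + c)) + m (T (2 * N + c)) \<le> m ((\<Union>k<N. T (2 * k + c)) \<union> T (2 * N + c))"
          proof (cases "N = 0")
            case True
            then show ?thesis by (simp add: empty)
          next
            case False
            show ?thesis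
            proof (rule sep[of "1 / real (2 * N + c) - 1 / real (2 * N + c + 1)"])
              show "0 < 1 / real (2 * N + c) - 1 / real (2 * N + c + 1)"
                using e False by simp
            next
              fix x y assume x: "x \<in> (\<Union>k<N. T (2 * k + c))" and y: "y \<in> T (2 * N + c)"
              from x obtain k where k: "k < N" "x \<in> T (2 * k + c)" by auto
              have "1 / real (2 * N + c) \<le> 1 / real (Suc (Suc (2 * k + c)))"
                using k(1) by (intro divide_left_mono) auto
              also have "\<dots> \<le> infdist x C"
                using k(2) by (auto simp: T_def E_def)
              finally have 1: "1 / real (2 * N + c) \<le> infdist x C" .
              have 2: "infdist y C \<le> 1 / real (2 * N + c + 1)"
                using y by (auto simp: T_def E_def)
              show "1 / real (2 * N + c) - 1 / real (2 * N + c + 1) \<le> dist x y"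
                using 1 2 infdist_triangle[of x C y] by linarith
            qed
          qed
          then have "m (\<Union>k<N. T (2 * k + c)) + m (T (2 * N + c)) \<le> m (\<Union>k<Suc N. T (2 * k + c))"
            by (simp add: lessThan_Suc Un_commute)
          then show ?case
            using add_right_mono[OF Suc.IH, of "m (T (2 * N + c))"]
            unfolding sum.lessThan_Suc by (rule order_trans[rotated])
        qed
        also have "\<dots> \<le> m A"
          by (rule mono) (auto simp: T_def E_def)
        finally show ?thesis .
      qed
      have T_fin: "(\<Sum>k. m (T k)) \<le> m A + m A"
      proof (rule suminf_le_const[OF summableI])
        fix n
        have "(\<Sum>k<n. m (T k)) \<le> (\<Sum>k<2 * n. m (T k))"
          by (rule sum_mono2) auto
        also have "\<dots> = (\<Sum>k<n. m (T (2 * k + 0))) + (\<Sum>k<n. m (T (2 * k + 1)))"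
          by (induction n) (auto simp: algebra_simps)
        also have "\<dots> \<le> m A + m A"
          by (intro add_mono T_sum)
        finally show "(\<Sum>k<n. m (T k)) \<le> m A + m A" .
      qed
      then have S_fin: "(\<Sum>k. m (T k)) < top"
        using False by (metis ennreal_add_eq_top less_top order.strict_trans1)
      define tail where "tail N = (\<Sum>k. m (T (k + N)))" for N
      have bound: "m (A \<inter> C) + m (A - C) \<le> m A + tail N" for N
      proof -
        have cover: "A - C \<subseteq> E N \<union> (\<Union>k. T (k + N))"
        proof
          fix x assume x: "x \<in> A - C"
          then have "0 < infdist x C"
            using C ne in_closed_iff_infdist_zero[of C x] infdist_nonneg[of x C] by force
          then obtain n where n: "1 / real (Suc n) < infdist x C"
            using nat_approx_posE by blast
          define k where "k = (LEAST k. x \<in> E k)"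
          have "x \<in> E n"
            using n x by (auto simp: E_def)
          then have k: "x \<in> E k" "\<And>j. j < k \<Longrightarrow> x \<notin> E j"
            unfolding k_def by (auto intro: LeastI dest: not_less_Least)
          show "x \<in> E N \<union> (\<Union>k. T (k + N))"
          proof (cases "k \<le> N")
            case True
            then have "1 / real (Suc N) \<le> 1 / real (Suc k)"
              by (intro divide_left_mono) auto
            then show ?thesis
              using k(1) by (auto simp: E_def)
          next
            case False
            then obtain j where j: "k = Suc (j + N)"
              by (metis add.commute less_imp_Suc_add not_le)
            then have "x \<in> T (j + N)"
              using k by (auto simp: T_def)
            then show ?thesis by blast
          qed
        qed
        have "m (A - C) \<le> m (E N) + m (\<Union>k. T (k + N))"
          using order_trans[OF mono[OF cover] sub2] .
        also have "\<dots> \<le> m (E N) + tail N"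
          unfolding tail_def by (intro add_left_mono csub)
        finally have "m (A \<inter> C) + m (A - C) \<le> m (A \<inter> C) + (m (E N) + tail N)"
          by (rule add_left_mono)
        also have "\<dots> = m (A \<inter> C) + m (E N) + tail N"
          by (simp add: add.assoc)
        also have "m (A \<inter> C) + m (E N) \<le> m (A \<inter> C \<union> E N)"
        proof (rule sep[of "1 / real (Suc N)"])
          fix x y assume "x \<in> A \<inter> C" "y \<in> E N"
          then show "1 / real (Suc N) \<le> dist x y"
            using infdist_le[of x C y] by (auto simp: E_def dist_commute)
        qed simp
        also have "\<dots> \<le> m A"
          by (rule mono) (auto simp: E_def)
        finally show ?thesis
          by (simp add: add_right_mono)
      qed
      have approx: "m (A \<inter> C) + m (A - C) \<le> m A + ennreal r" if r: "0 < r" for r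
      proof -
        let ?S = "\<Sum>k. m (T k)"
        have "\<exists>N. ?S < (\<Sum>k<N. m (T k)) + ennreal r"
        proof (rule ccontr)
          assume "\<not> ?thesis"
          then have "\<And>N. (\<Sum>k<N. m (T k)) + ennreal r \<le> ?S"
            by (simp add: not_less)
          then have "?S + ennreal r \<le> ?S"
            by (rule ennreal_suminf_bound_add)
          moreover obtain s where "0 \<le> s" "?S = ennreal s"
            using S_fin by (cases "?S") auto
          ultimately show False
            using r by (simp flip: ennreal_plus)
        qed
        then obtain N where N: "?S < (\<Sum>k<N. m (T k)) + ennreal r" by blast
        have eq: "?S = tail N + (\<Sum>k<N. m (T k))"
          unfolding tail_def by (rule suminf_offset[OF summableI])
        have "tail N \<le> ennreal r"
        proof (rule ccontr)
          assume "\<not> ?thesis"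
          then have "(\<Sum>k<N. m (T k)) + ennreal r \<le> tail N + (\<Sum>k<N. m (T k))"
            by (subst add.commute) (intro add_right_mono, simp)
          then show False
            using N unfolding eq by (meson leD)
        qed
        then show ?thesis
          using bound[of N] by (meson add_left_mono order_trans)
      qed
      show ?thesis
        by (rule ennreal_le_epsilon) (rule approx)
    next
      case True
      then show ?thesis by simp
    qed
    show ?thesis
      unfolding P.lambda_system_eq
    proof (intro CollectI conjI ballI)
      show "C \<in> Pow UNIV" by simp
    next
      fix A :: "'a set"
      have "m A \<le> m (A \<inter> C) + m (A - C)"
        using sub2[of "A \<inter> C" "A - C"] by (simp add: Int_Diff_Un)
      with le[of A] show "m (A \<inter> C) + m (A - C) = m A"
        by (rule antisym)
    qed
  qed
  have ms: "measure_space UNIV (lambda_system UNIV (Pow UNIV) m) m"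
    by (rule P.caratheodory_lemma[OF oms])
  then interpret L: sigma_algebra UNIV "lambda_system UNIV (Pow UNIV) m"
    by (simp add: measure_space_def)
  have "sigma_sets UNIV {C :: 'a set. closed C} \<subseteq> lambda_system UNIV (Pow UNIV) m"
    by (rule L.sigma_sets_subset) (use closed_in in blast)
  then have "sets borel \<subseteq> lambda_system UNIV (Pow UNIV) m"
    unfolding borel_eq_closed by simp
  then show ?thesis
    using measure_down[OF ms] sets.sigma_algebra_axioms[of "borel :: 'a measure"] by simp
qed

lemma hausdorff_premeasure_le:
  "hausdorff_cover \<delta> A U \<Longrightarrow> hausdorff_premeasure d \<delta> A \<le> (\<Sum>i. hausdorff_cost d (U i))"
  unfolding hausdorff_premeasure_def by (rule INF_lower) auto

lemma hausdorff_premeasure_antimono: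
  "\<delta> \<le> \<delta>' \<Longrightarrow> hausdorff_premeasure d \<delta>' A \<le> hausdorff_premeasure d \<delta> A"
  unfolding hausdorff_premeasure_def
  by (rule INF_superset_mono) (auto simp: hausdorff_cover_def, meson order_trans)

lemma hausdorff_premeasure_le_outer:
  "0 < \<delta> \<Longrightarrow> hausdorff_premeasure d \<delta> A \<le> hausdorff_outer d A"
  unfolding hausdorff_outer_def by (rule SUP_upper) auto

lemma hausdorff_premeasure_UN:
  fixes A :: "nat \<Rightarrow> 'a::metric_space set"
  shows "hausdorff_premeasure d \<delta> (\<Union>i. A i) \<le> (\<Sum>i. hausdorff_premeasure d \<delta> (A i))"
proof (rule ennreal_le_epsilon)
  let ?O = "hausdorff_premeasure d \<delta> :: 'a set \<Rightarrow> ennreal"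
  fix e :: real assume "0 < e" "(\<Sum>n. ?O (A n)) < top"
  then have *: "\<And>n. ?O (A n) < ?O (A n) + e * (1/2)^Suc n"
    by (auto simp add: less_top dest!: ennreal_suminf_lessD)
  have "\<exists>B. hausdorff_cover \<delta> (A n) B \<and> (\<Sum>i. hausdorff_cost d (B i)) \<le> ?O (A n) + e * (1/2)^Suc n" for n
  proof -
    obtain B where "hausdorff_cover \<delta> (A n) B" "(\<Sum>i. hausdorff_cost d (B i)) < ?O (A n) + e * (1/2)^Suc n"
      using *[of n]
      by (subst (asm) hausdorff_premeasure_def) (auto simp only: INF_less_iff mem_Collect_eq)
    then show ?thesis
      by (blast intro: less_imp_le)
  qed
  then obtain B where B: "\<And>n. hausdorff_cover \<delta> (A n) (B n)"
    and Ble: "\<And>n. (\<Sum>i. hausdorff_cost d (B n i)) \<le> ?O (A n) + e * (1/2)^Suc n"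
    by metis
  define C where "C = case_prod B o prod_decode"
  have "hausdorff_cover \<delta> (\<Union>i. A i) C"
    unfolding hausdorff_cover_def
  proof safe
    fix x n assume "x \<in> A n"
    then obtain i where "x \<in> B n i"
      using B[of n] by (auto simp: hausdorff_cover_def)
    then have "x \<in> C (prod_encode (n, i))"
      by (simp add: C_def)
    then show "x \<in> (\<Union>i. C i)" by blast
  qed (use B in \<open>auto simp: C_def hausdorff_cover_def split_def\<close>)
  then have "?O (\<Union>i. A i) \<le> (\<Sum>i. hausdorff_cost d (C i))"
    by (rule hausdorff_premeasure_le)
  also have "\<dots> = (\<Sum>i. (\<lambda>(n, i). hausdorff_cost d (B n i)) (prod_decode i))"
    by (simp add: C_def split_def)
  also have "\<dots> = (\<Sum>n. \<Sum>i. hausdorff_cost d (B n i))"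
    by (subst suminf_ennreal_2dimen[symmetric, where g = "\<lambda>n. \<Sum>i. hausdorff_cost d (B n i)"])
       (auto simp: comp_def)
  also have "\<dots> \<le> (\<Sum>n. ?O (A n) + e * (1/2) ^ Suc n)"
    by (intro suminf_le allI Ble) auto
  also have "\<dots> = (\<Sum>n. ?O (A n)) + (\<Sum>n. ennreal e * ennreal ((1/2) ^ Suc n))"
    using \<open>0 < e\<close> by (subst suminf_add[symmetric])
      (auto simp del: ennreal_suminf_cmult simp add: ennreal_mult[symmetric])
  also have "\<dots> = (\<Sum>n. ?O (A n)) + e"
    unfolding ennreal_suminf_cmult
    by (subst suminf_ennreal_eq[OF zero_le_power power_half_series]) auto
  finally show "?O (\<Union>i. A i) \<le> (\<Sum>n. ?O (A n)) + e" .
qed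

lemma hausdorff_premeasure_separated:
  fixes A B :: "'a::metric_space set"
  assumes "\<delta> < e" and AB: "\<And>x y. x \<in> A \<Longrightarrow> y \<in> B \<Longrightarrow> e \<le> dist x y"
  shows "hausdorff_premeasure d \<delta> A + hausdorff_premeasure d \<delta> B \<le> hausdorff_premeasure d \<delta> (A \<union> B)"
  unfolding hausdorff_premeasure_def[of d \<delta> "A \<union> B"]
proof (rule INF_greatest)
  fix U assume "U \<in> {U. hausdorff_cover \<delta> (A \<union> B) U}"
  then have U: "A \<subseteq> (\<Union>i. U i)" "B \<subseteq> (\<Union>i. U i)" "\<And>i. bounded (U i)" "\<And>i. diameter (U i) \<le> \<delta>"
    by (simp_all add: hausdorff_cover_def)
  define V where "V S i = (if U i \<inter> S = {} then {} else U i)" for S i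
  have V: "hausdorff_cover \<delta> S (V S)" if S: "S \<subseteq> (\<Union>i. U i)" for S
  proof -
    have nn: "0 \<le> \<delta>"
      using diameter_ge_0[OF U(3)[of 0]] U(4)[of 0] by linarith
    have "bounded (V S i) \<and> diameter (V S i) \<le> \<delta>" for i
      using nn U(3)[of i] U(4)[of i] by (simp add: V_def)
    moreover have "S \<subseteq> (\<Union>i. V S i)"
    proof
      fix x assume x: "x \<in> S"
      then obtain i where "x \<in> U i" using S by blast
      with x have "x \<in> V S i" by (auto simp: V_def)
      then show "x \<in> (\<Union>i. V S i)" by blast
    qed
    ultimately show ?thesis
      by (simp add: hausdorff_cover_def)
  qed
  have split: "hausdorff_cost d (V A i) + hausdorff_cost d (V B i) \<le> hausdorff_cost d (U i)" for i
  proof -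
    have "U i \<inter> A = {} \<or> U i \<inter> B = {}"
    proof (rule ccontr)
      assume "\<not> ?thesis"
      then obtain x y where xy: "x \<in> U i" "x \<in> A" "y \<in> U i" "y \<in> B" by blast
      have "dist x y \<le> \<delta>"
        using diameter_bounded_bound[OF U(3)[of i] xy(1,3)] U(4)[of i] by linarith
      then show False
        using AB[OF xy(2,4)] \<open>\<delta> < e\<close> by linarith
    qed
    then show ?thesis
      by (auto simp: V_def hausdorff_cost_def)
  qed
  have "hausdorff_premeasure d \<delta> A + hausdorff_premeasure d \<delta> B
      \<le> (\<Sum>i. hausdorff_cost d (V A i)) + (\<Sum>i. hausdorff_cost d (V B i))"
    by (intro add_mono hausdorff_premeasure_le V U)
  also have "\<dots> = (\<Sum>i. hausdorff_cost d (V A i) + hausdorff_cost d (V B i))"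
    by (rule suminf_add) auto
  also have "\<dots> \<le> (\<Sum>i. hausdorff_cost d (U i))"
    by (intro suminf_le split) auto
  finally show "hausdorff_premeasure d \<delta> A + hausdorff_premeasure d \<delta> B \<le> (\<Sum>i. hausdorff_cost d (U i))" .
qed

lemma hausdorff_outer_empty: "hausdorff_outer d ({} :: 'a::metric_space set) = 0"
proof -
  have "hausdorff_premeasure d \<delta> ({} :: 'a set) = 0" if "0 < \<delta>" for \<delta>
    using hausdorff_premeasure_le[of \<delta> "{} :: 'a set" "\<lambda>_. {}" d] that
    by (simp add: hausdorff_cover_def hausdorff_cost_def)
  then show ?thesis
    by (simp add: hausdorff_outer_def)
qed

lemma hausdorff_outer_mono: "A \<subseteq> B \<Longrightarrow> hausdorff_outer d A \<le> hausdorff_outer d B"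
  unfolding hausdorff_outer_def
proof (rule SUP_mono')
  fix \<delta> assume "A \<subseteq> B"
  then show "hausdorff_premeasure d \<delta> A \<le> hausdorff_premeasure d \<delta> B"
    unfolding hausdorff_premeasure_def
    by (intro INF_superset_mono Collect_mono) (auto simp only: hausdorff_cover_def intro: subset_trans)
qed

lemma hausdorff_outer_UN:
  fixes A :: "nat \<Rightarrow> 'a::metric_space set"
  shows "hausdorff_outer d (\<Union>i. A i) \<le> (\<Sum>i. hausdorff_outer d (A i))"
  unfolding hausdorff_outer_def[of d "\<Union>i. A i"]
proof (rule SUP_least)
  fix \<delta> :: real assume "\<delta> \<in> {0<..}"
  then have "(\<Sum>i. hausdorff_premeasure d \<delta> (A i)) \<le> (\<Sum>i. hausdorff_outer d (A i))"
    by (intro suminf_le hausdorff_premeasure_le_outer) auto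
  then show "hausdorff_premeasure d \<delta> (\<Union>i. A i) \<le> (\<Sum>i. hausdorff_outer d (A i))"
    using hausdorff_premeasure_UN order_trans by blast
qed

lemma hausdorff_outer_separated:
  fixes A B :: "'a::metric_space set"
  assumes "0 < e" and AB: "\<And>x y. x \<in> A \<Longrightarrow> y \<in> B \<Longrightarrow> e \<le> dist x y"
  shows "hausdorff_outer d A + hausdorff_outer d B \<le> hausdorff_outer d (A \<union> B)"
proof -
  have *: "hausdorff_premeasure d \<delta> A + hausdorff_premeasure d \<delta>' B \<le> hausdorff_outer d (A \<union> B)"
    if "0 < \<delta>" "0 < \<delta>'" for \<delta> \<delta>'
  proof -
    define \<epsilon> where "\<epsilon> = min (min \<delta> \<delta>') (e / 2)"
    have \<epsilon>: "0 < \<epsilon>" "\<epsilon> \<le> \<delta>" "\<epsilon> \<le> \<delta>'" "\<epsilon> < e"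
      using that \<open>0 < e\<close> by (auto simp: \<epsilon>_def min_def)
    have "hausdorff_premeasure d \<delta> A + hausdorff_premeasure d \<delta>' B
        \<le> hausdorff_premeasure d \<epsilon> A + hausdorff_premeasure d \<epsilon> B"
      by (intro add_mono hausdorff_premeasure_antimono \<epsilon>)
    also have "\<dots> \<le> hausdorff_premeasure d \<epsilon> (A \<union> B)"
      using \<epsilon>(4) AB by (rule hausdorff_premeasure_separated)
    also have "\<dots> \<le> hausdorff_outer d (A \<union> B)"
      using \<epsilon>(1) by (rule hausdorff_premeasure_le_outer)
    finally show ?thesis .
  qed
  have ne: "{0 :: real <..} \<noteq> {}"
    by simp
  have "hausdorff_outer d A + hausdorff_outer d B
      = (SUP \<delta>\<in>{0<..}. SUP \<delta>'\<in>{0<..}. hausdorff_premeasure d \<delta> A + hausdorff_premeasure d \<delta>' B)"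
    unfolding hausdorff_outer_def
    by (simp add: ennreal_SUP_add_left[OF ne, symmetric] ennreal_SUP_add_right[OF ne, symmetric] del: greaterThan_iff)
  also have "\<dots> \<le> hausdorff_outer d (A \<union> B)"
    by (intro SUP_least *) auto
  finally show ?thesis .
qed

lemma space_hausdorff_measure [simp]: "space (hausdorff_measure d) = UNIV"
  by (simp add: hausdorff_measure_def space_measure_of_conv)

lemma sets_hausdorff_measure [simp, measurable_cong]: "sets (hausdorff_measure d) = sets borel"
  unfolding hausdorff_measure_def using sets.sets_measure_of_eq[of borel "hausdorff_outer d"] by simp

theorem emeasure_hausdorff_measure:
  fixes A :: "'a::metric_space set"
  assumes "A \<in> sets borel"
  shows "emeasure (hausdorff_measure d) A = hausdorff_outer d A"
proof -
  have "measure_space UNIV (sets (borel :: 'a measure)) (hausdorff_outer d)"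
  proof (rule metric_outer_measure_space)
    fix e :: real and A B :: "'a set"
    assume "0 < e" "\<And>x y. x \<in> A \<Longrightarrow> y \<in> B \<Longrightarrow> e \<le> dist x y"
    then show "hausdorff_outer d A + hausdorff_outer d B \<le> hausdorff_outer d (A \<union> B)"
      by (rule hausdorff_outer_separated)
  qed (fact hausdorff_outer_empty hausdorff_outer_UN | erule hausdorff_outer_mono)+
  then show ?thesis
    unfolding hausdorff_measure_def using assms
    by (intro emeasure_measure_of_sigma) (auto simp: measure_space_def)
qed

end

theory Submission
  imports Defs
begin

text \<open>
  Write \<open>\<rho>(u) = \<bar>\<phi>(u)\<bar>\<close>, so that \<open>\<phi>(u) = \<rho>(u) u\<close>; the inverse of \<open>\<phi>\<close> is \<open>x \<mapsto> x / \<bar>x\<bar>\<close>, which is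
  continuous on the compact set \<open>M\<close>. Two identities for unit vectors \<open>z\<close>, \<open>u\<close> carry the metric part:

  \<^item> \<open>\<bar>\<phi>(z) - \<phi>(u)\<bar>\<^sup>2 = (\<rho>(z) - \<rho>(u))\<^sup>2 + \<rho>(z) \<rho>(u) \<bar>z - u\<bar>\<^sup>2\<close>;
  \<^item> \<open>sin \<beta> \<bar>\<phi>(z) - \<phi>(u)\<bar> = \<rho>(z) d sqrt (1 - d\<^sup>2 / 4)\<close>, where \<open>d = \<bar>z - u\<bar>\<close> and \<open>\<beta>\<close> is the acute angle
    between the segment \<open>[\<phi>(z), \<phi>(u)]\<close> and the ray through \<open>u\<close>.

  The first identity bounds the Lipschitz constant of the inverse by \<open>1 / dist(M, 0)\<close>. The bound is
  reached at arbitrarily small scales: on a great circle through a minimum point of \<open>\<rho>\<close>, the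
  intermediate value theorem gives two distinct points close to the minimum with equal \<open>\<rho>\<close>
  (\<open>exists_close_pair_with_equal_radius\<close>).

  The second identity shows that the local dilatation of \<open>\<phi>\<close> at \<open>u\<close> is \<open>\<bar>x\<bar> / sin \<alpha>(x)\<close> with
  \<open>x = \<phi>(u)\<close> (\<open>eventually_dist_phi_le\<close>, \<open>rho_le_mult_sin_angle\<close>). What remains is a passage from local
  to global: if \<open>\<alpha>\<close> is bounded below by a positive constant and \<open>\<bar>x\<bar> \<le> \<Lambda> sin \<alpha>(x)\<close> for almost every
  \<open>x\<close> in \<open>M\<close>, then \<open>\<phi>\<close> is \<open>\<Lambda>\<close>-Lipschitz for the chordal metric (\<open>lipschitz_on_phi_of_ae_bound\<close>).

  For this let \<open>L > \<Lambda>\<close>. Along a great circle parametrised by arc length, the first identity turns the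
  local bound into a bound by 1 on the local dilatation of \<open>arcsin (\<rho> / L)\<close>; equality would hold on
  circles of diameter \<open>L\<close> through the origin. If the arc meets the exceptional set in a null set, then
  \<open>arcsin (\<rho> / L)\<close> is 1-Lipschitz on the whole arc (\<open>abs_increment_le_of_local_bounds\<close>), and an
  elementary trigonometric inequality (\<open>sin_diff_le_of_angle_le\<close>) converts this into the bound \<open>L\<close> for
  the ratio of chords. Almost every arc is of this kind: the cone over an \<open>(n-1)\<close>-dimensional null set
  is Lebesgue null in \<open>n\<close>-space (\<open>negligible_cone_of_hausdorff_null\<close>), and by Fubini almost every
  translate of a given line meets it in a null set (\<open>exists_negligible_line_section\<close>); the radial
  projection of a segment on such a line is an arc of the required kind. Arbitrary pairs of points are
  limits of such end points, and antipodal points are treated directly.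

  With an empty exceptional set this gives the bi-Lipschitz criterion and the formula for \<open>Lip \<phi>\<close> as
  the supremum of local dilatations; with a null exceptional set it gives the essential supremum.
\<close>

section \<open>Lipschitz constants\<close>

lemma Lip_le:
  "L-lipschitz_on X f \<Longrightarrow> Lip X f \<le> ereal L"
  unfolding Lip_def by (rule Inf_lower) auto

text \<open>A limit from above of Lipschitz constants is a Lipschitz constant.\<close>

lemma lipschitz_on_of_greater:
  assumes K: "\<And>K. L < K \<Longrightarrow> K-lipschitz_on X f"
  shows "L-lipschitz_on X f"
proof (rule lipschitz_onI)
  fix x y assume xy: "x \<in> X" "y \<in> X"
  have "((\<lambda>K. K * dist x y) \<longlongrightarrow> L * dist x y) (at_right L)"
    by (intro tendsto_intros)
  moreover have "\<forall>\<^sub>F K in at_right L. dist (f x) (f y) \<le> K * dist x y"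
    using eventually_at_right_less by (rule eventually_mono) (use K xy lipschitz_onD in blast)
  ultimately show "dist (f x) (f y) \<le> L * dist x y"
    by (rule tendsto_lowerbound) simp
next
  show "0 \<le> L"
    using K lipschitz_on_nonneg by (blast intro: dense_ge)
qed

lemma lipschitz_on_of_bi_lipschitz:
  assumes "bi_lipschitz X Y f"
  obtains K where "K-lipschitz_on X f"
proof -
  obtain K where "1 \<le> K" "\<forall>x\<in>X. \<forall>y\<in>X. dist x y / K \<le> dist (f x) (f y) \<and> dist (f x) (f y) \<le> K * dist x y"
    using assms unfolding bi_lipschitz_def by (elim conjE exE)
  then have "K-lipschitz_on X f"
    by (intro lipschitz_onI) simp_all
  then show thesis by (rule that)
qed

section \<open>From local bounds to increments on an interval\<close>

text \<open>On the exceptional null set any constant \<open>K\<close> suffices: an open set \<open>U\<close> of small measure that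
  contains it contributes at most \<open>K\<close> times its measure to the increment.\<close>

lemma abs_increment_le_of_local_bounds:
  fixes f :: "real \<Rightarrow> real"
  assumes ab: "a \<le> b" and N: "negligible N"
    and good: "\<And>s. s \<in> {a..b} - N \<Longrightarrow> \<forall>\<^sub>F t in at s. \<bar>f t - f s\<bar> \<le> \<bar>t - s\<bar>"
    and bad: "\<And>s. s \<in> {a..b} \<inter> N \<Longrightarrow> \<forall>\<^sub>F t in at s. \<bar>f t - f s\<bar> \<le> K * \<bar>t - s\<bar>"
  shows "\<bar>f b - f a\<bar> \<le> b - a"
proof (rule field_le_epsilon)
  fix e :: real assume e: "0 < e"
  define k where "k = max K 0"
  have k: "0 \<le> k" "K \<le> k" by (auto simp: k_def)
  have N_sets: "N \<in> sets lebesgue"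
    using N by (simp add: negligible_imp_sets)
  have pos: "0 < e / (k + 1)" using e k by simp
  obtain U where U: "open U" "N \<subseteq> U" and UN: "U - N \<in> lmeasurable" "emeasure lebesgue (U - N) < ennreal (e / (k + 1))"
    using sets_lebesgue_outer_open[OF N_sets pos] by metis
  have "N \<union> (U - N) \<in> lmeasurable"
    using N UN(1) by (intro fmeasurable.Un) (auto simp: negligible_iff_measure)
  then have U_meas: "U \<in> lmeasurable"
    using U(2) by (simp add: Un_absorb1)
  have "emeasure lebesgue U = emeasure lebesgue ((U - N) \<union> N)"
    using U(2) by (simp add: Un_absorb2)
  also have "\<dots> = emeasure lebesgue (U - N)"
    using N UN(1) by (intro emeasure_Un_null_set) (auto simp: negligible_iff_null_sets)
  also have "\<dots> < ennreal (e / (k + 1))"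
    by (rule UN(2))
  finally have U_small: "measure lebesgue U < e / (k + 1)"
    using U_meas pos by (simp add: emeasure_eq_measure2 ennreal_less_iff)
  define \<mu> where "\<mu> s t = measure lebesgue (U \<inter> {s<..t})" for s t
  have meas: "U \<inter> {s<..t} \<in> lmeasurable" for s t
    by (rule fmeasurable_Int_fmeasurable) (use U_meas in \<open>auto\<close>)
  have mu_nonneg: "0 \<le> \<mu> s t" for s t by (simp add: \<mu>_def)
  \<comment> \<open>The bound is additive over adjacent intervals, so that it need only be checked around each point.\<close>
  have "\<bar>f b - f a\<bar> \<le> (b - a) + k * \<mu> a b"
  proof (rule Bolzano[of a b "\<lambda>s t. \<bar>f t - f s\<bar> \<le> (t - s) + k * \<mu> s t"])
    show "a \<le> b" by fact
  next
    fix r s t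
    assume rs: "\<bar>f s - f r\<bar> \<le> (s - r) + k * \<mu> r s" and st: "\<bar>f t - f s\<bar> \<le> (t - s) + k * \<mu> s t"
      and le: "r \<le> s" "s \<le> t"
    have "\<mu> r t = measure lebesgue ((U \<inter> {r<..s}) \<union> (U \<inter> {s<..t}))"
      unfolding \<mu>_def by (rule arg_cong[where f = "measure lebesgue"]) (use le in auto)
    also have "\<dots> = \<mu> r s + \<mu> s t"
      unfolding \<mu>_def using meas by (intro measure_Union) (auto simp: fmeasurable_def less_top[symmetric] simp del: emeasure_completion)
    finally have "k * \<mu> r t = k * \<mu> r s + k * \<mu> s t" by (simp add: distrib_left)
    then show "\<bar>f t - f r\<bar> \<le> (t - r) + k * \<mu> r t"
      using rs st by linarith
  next
    fix x assume x: "a \<le> x" "x \<le> b"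
    show "\<exists>d>0. \<forall>s t. s \<le> x \<and> x \<le> t \<and> t - s < d \<longrightarrow> \<bar>f t - f s\<bar> \<le> (t - s) + k * \<mu> s t"
    proof (cases "x \<in> N")
      case False
      then have "\<forall>\<^sub>F t in at x. \<bar>f t - f x\<bar> \<le> \<bar>t - x\<bar>"
        using good x by auto
      then obtain d where d: "d > 0" "\<And>t. t \<noteq> x \<Longrightarrow> \<bar>t - x\<bar> < d \<Longrightarrow> \<bar>f t - f x\<bar> \<le> \<bar>t - x\<bar>"
        by (auto simp: eventually_at dist_real_def)
      have *: "\<bar>f t - f x\<bar> \<le> \<bar>t - x\<bar>" if "\<bar>t - x\<bar> < d" for t
        using d(2)[of t] that by (cases "t = x") auto
      show ?thesis
      proof (intro exI[of _ d] conjI allI impI)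
        fix s t assume st: "s \<le> x \<and> x \<le> t \<and> t - s < d"
        have "0 \<le> k * \<mu> s t" using k(1) mu_nonneg by simp
        then show "\<bar>f t - f s\<bar> \<le> (t - s) + k * \<mu> s t"
          using *[of s] *[of t] st by linarith
      qed (fact d(1))
    next
      case True
      then have "\<forall>\<^sub>F t in at x. \<bar>f t - f x\<bar> \<le> K * \<bar>t - x\<bar>"
        using bad x by auto
      then obtain d where d: "d > 0" "\<And>t. t \<noteq> x \<Longrightarrow> \<bar>t - x\<bar> < d \<Longrightarrow> \<bar>f t - f x\<bar> \<le> K * \<bar>t - x\<bar>"
        by (auto simp: eventually_at dist_real_def)
      have *: "\<bar>f t - f x\<bar> \<le> k * \<bar>t - x\<bar>" if "\<bar>t - x\<bar> < d" for t
        using d(2)[of t] that mult_right_mono[OF k(2), of "\<bar>t - x\<bar>"] by (cases "t = x") (simp, linarith)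
      obtain d' where d': "d' > 0" "ball x d' \<subseteq> U"
        using U True by (meson openE subsetD)
      show ?thesis
      proof (intro exI[of _ "min d d'"] conjI allI impI)
        fix s t assume st: "s \<le> x \<and> x \<le> t \<and> t - s < min d d'"
        have "U \<inter> {s<..t} = {s<..t}"
          using d'(2) st by (auto simp: dist_real_def subset_eq)
        then have "\<mu> s t = t - s"
          using st by (simp add: \<mu>_def)
        moreover have "\<bar>f s - f x\<bar> \<le> k * (x - s)" "\<bar>f t - f x\<bar> \<le> k * (t - x)"
          using *[of s] *[of t] st by (auto simp: abs_of_nonpos)
        then have "\<bar>f t - f s\<bar> \<le> k * (t - x) + k * (x - s)" by linarith
        moreover have "k * (t - s) = k * (t - x) + k * (x - s)"
          by (simp add: algebra_simps)
        ultimately show "\<bar>f t - f s\<bar> \<le> (t - s) + k * \<mu> s t"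
          using st by simp
      qed (use d(1) d'(1) in auto)
    qed
  qed
  also have "k * \<mu> a b \<le> k * measure lebesgue U"
    unfolding \<mu>_def using k(1) U_meas meas
    by (intro mult_left_mono measure_mono_fmeasurable) (auto simp: fmeasurableD)
  also have "\<dots> \<le> k * (e / (k + 1))"
    using k U_small by (intro mult_left_mono) auto
  also have "\<dots> \<le> e"
    using k e by (simp add: field_simps)
  finally show "\<bar>f b - f a\<bar> \<le> b - a + e" by simp
qed

section \<open>Cones over null sets of the Hausdorff measure\<close>

text \<open>A set of diameter \<open>d\<close> has a truncated cone of height \<open>T\<close> that is covered by about \<open>T / d\<close> balls of
  radius comparable to \<open>d\<close>, hence of volume comparable to \<open>d\<close> to the power \<open>n - 1\<close>. A single point has cost
  \<open>0\<close>, and its cone is a segment, which is a null set because \<open>n \<ge> 2\<close>.\<close>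

lemma truncated_cone_cover:
  fixes U :: "'a::euclidean_space set"
  assumes dim: "2 \<le> DIM('a)" and U: "U \<subseteq> cball 0 R" "diameter U \<le> 1" and T: "0 < T"
  defines "K \<equiv> (T + 2) * unit_ball_vol DIM('a) * (T + R) ^ DIM('a) * 2 ^ (DIM('a) - 1) / unit_ball_vol (real (DIM('a) - 1))"
  obtains V where "V \<in> sets borel" "(\<Union>t\<in>{0..T}. (*\<^sub>R) t ` U) \<subseteq> V"
    "emeasure lborel V \<le> ennreal K * hausdorff_cost (DIM('a) - 1) U"
proof (cases "U = {}")
  case True
  then show thesis by (intro that[of "{}"]) auto
next
  case False
  then obtain x0 where x0: "x0 \<in> U" by auto
  have bU: "bounded U" using U(1) bounded_cball bounded_subset by blast
  have R: "norm x0 \<le> R" "0 \<le> R"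
    using U(1) x0 by (auto simp: subset_eq dest: order_trans[OF norm_ge_zero])
  define d where "d = diameter U"
  have d0: "0 \<le> d" using bU by (simp add: d_def diameter_ge_0)
  have dist_le: "norm (x - x0) \<le> d" if "x \<in> U" for x
    using diameter_bounded_bound[OF bU that x0] by (simp add: d_def dist_norm)
  show thesis
  proof (cases "d = 0")
    case True
    have "U = {x0}" using dist_le x0 True by fastforce
    have "negligible (span {x0})"
    proof (rule negligible_lowdim)
      have "dim (span {x0}) \<le> card {x0}"
        by (simp only: dim_span) (rule dim_le_card', simp)
      then show "dim (span {x0}) < DIM('a)" using dim by simp
    qed
    moreover have "span {x0} \<in> sets borel"
      by (intro borel_closed closed_subspace subspace_span)
    ultimately have "emeasure lborel (span {x0}) = 0"
      by (simp add: negligible_iff_null_sets null_sets_completion_iff null_setsD1)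
    then show thesis
      using \<open>U = {x0}\<close> \<open>span {x0} \<in> sets borel\<close>
      by (intro that[of "span {x0}"]) (auto simp: span_mul span_base)
  next
    case False
    then have d: "0 < d" "d \<le> 1" using d0 U(2) by (auto simp: d_def)
    \<comment> \<open>balls centred at the multiples of \<open>d x0\<close> along the ray through \<open>x0\<close>\<close>
    define m where "m = nat \<lfloor>T / d\<rfloor>"
    define V where "V = (\<Union>k\<le>m. cball ((real k * d) *\<^sub>R x0) (d * (T + R)))"
    have m: "real m \<le> T / d" using d T by (simp add: m_def)
    have rad: "0 \<le> d * (T + R)" using d T R by simp
    have sub: "t *\<^sub>R x \<in> V" if t: "0 \<le> t" "t \<le> T" and x: "x \<in> U" for t x
    proof -
      define k where "k = nat \<lfloor>t / d\<rfloor>"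
      have "0 \<le> t / d" using t d by simp
      then have k: "real k \<le> t / d" "t / d < real k + 1"
        unfolding k_def by linarith+
      have "k \<le> m" unfolding k_def m_def using t d by (intro nat_mono floor_mono divide_right_mono) auto
      have "\<bar>t - real k * d\<bar> \<le> d" using k d by (simp add: field_simps abs_le_iff)
      have "t *\<^sub>R x - (real k * d) *\<^sub>R x0 = t *\<^sub>R (x - x0) + (t - real k * d) *\<^sub>R x0"
        by (simp add: algebra_simps)
      then have "norm (t *\<^sub>R x - (real k * d) *\<^sub>R x0) \<le> norm (t *\<^sub>R (x - x0)) + norm ((t - real k * d) *\<^sub>R x0)"
        by (metis norm_triangle_ineq)
      also have "\<dots> = t * norm (x - x0) + \<bar>t - real k * d\<bar> * norm x0"
        using t by simp
      also have "\<dots> \<le> T * d + d * R"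
        using t d T R dist_le[OF x] \<open>\<bar>t - real k * d\<bar> \<le> d\<close> by (intro add_mono mult_mono) auto
      finally have "t *\<^sub>R x \<in> cball ((real k * d) *\<^sub>R x0) (d * (T + R))"
        by (simp add: dist_norm norm_minus_commute algebra_simps)
      then show ?thesis using \<open>k \<le> m\<close> by (auto simp: V_def)
    qed
    have "emeasure lborel V \<le> (\<Sum>k\<le>m. emeasure lborel (cball ((real k * d) *\<^sub>R x0) (d * (T + R))))"
      unfolding V_def by (intro emeasure_subadditive_finite) auto
    also have "\<dots> = ennreal (real (Suc m) * (unit_ball_vol DIM('a) * (d * (T + R)) ^ DIM('a)))"
      using rad by (simp add: emeasure_cball ennreal_mult' flip: ennreal_of_nat_eq_real_of_nat)
    also have "\<dots> \<le> ennreal (K * (unit_ball_vol (real (DIM('a) - 1)) * (d / 2) ^ (DIM('a) - 1)))"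
    proof (rule ennreal_leI)
      have *: "d ^ DIM('a) = d * d ^ (DIM('a) - 1)"
        using dim by (metis DIM_positive power_minus_mult mult.commute)
      have "real (Suc m) * d \<le> T + 2"
        using m d by (simp add: field_simps)
      then have "(real (Suc m) * d) * (unit_ball_vol DIM('a) * (T + R) ^ DIM('a) * d ^ (DIM('a) - 1))
          \<le> (T + 2) * (unit_ball_vol DIM('a) * (T + R) ^ DIM('a) * d ^ (DIM('a) - 1))"
        using T R d by (intro mult_right_mono) auto
      also have "\<dots> = K * (unit_ball_vol (real (DIM('a) - 1)) * (d / 2) ^ (DIM('a) - 1))"
      proof -
        define u where "u = unit_ball_vol (real (DIM('a) - 1))"
        have "0 < u" unfolding u_def by (intro unit_ball_vol_pos) simp
        then show ?thesis unfolding K_def u_def[symmetric] by (simp add: power_divide)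
      qed
      finally show "real (Suc m) * (unit_ball_vol DIM('a) * (d * (T + R)) ^ DIM('a))
          \<le> K * (unit_ball_vol (real (DIM('a) - 1)) * (d / 2) ^ (DIM('a) - 1))"
        by (simp add: * power_mult_distrib mult_ac)
    qed
    also have "\<dots> = ennreal K * hausdorff_cost (DIM('a) - 1) U"
    proof -
      have "0 \<le> K" unfolding K_def using T R by simp
      then show ?thesis
        using False d0 \<open>U \<noteq> {}\<close> by (simp add: hausdorff_cost_def ennreal_mult' flip: d_def)
    qed
    finally have "emeasure lborel V \<le> ennreal K * hausdorff_cost (DIM('a) - 1) U" .
    moreover have "V \<in> sets borel" by (auto simp: V_def)
    moreover have "(\<Union>t\<in>{0..T}. (*\<^sub>R) t ` U) \<subseteq> V" using sub by auto
    ultimately show thesis by (rule that[rotated 2])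
  qed
qed

lemma negligible_cone_of_hausdorff_null:
  fixes N :: "'a::euclidean_space set"
  assumes dim: "2 \<le> DIM('a)" and N: "bounded N" "hausdorff_outer (DIM('a) - 1) N = 0"
  shows "negligible (\<Union>t\<in>{0..}. (*\<^sub>R) t ` N)"
proof -
  let ?d = "DIM('a) - 1"
  obtain R where R: "N \<subseteq> cball 0 R" "0 < R"
    using N(1) unfolding bounded_pos by (auto simp: subset_eq)
  have "negligible (\<Union>t\<in>{0..real (Suc n)}. (*\<^sub>R) t ` N)" (is "negligible ?C") for n
  proof -
    define T where "T = real (Suc n)"
    have T: "0 < T" by (simp add: T_def)
    define K where "K = (T + 2) * unit_ball_vol DIM('a) * (T + R) ^ DIM('a) * 2 ^ ?d / unit_ball_vol (real ?d)"
    have K: "0 < K" unfolding K_def using T R(2) by simp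
    show ?thesis
      unfolding negligible_outer
    proof (intro allI impI)
      fix e :: real assume e: "0 < e"
      have "hausdorff_premeasure ?d 1 N = 0"
        using hausdorff_premeasure_le_outer[of 1 ?d N] N(2) by simp
      then have "hausdorff_premeasure ?d 1 N < ennreal (e / (2 * K))"
        using e K by simp
      then obtain U where U: "hausdorff_cover 1 N U" "(\<Sum>i. hausdorff_cost ?d (U i)) < ennreal (e / (2 * K))"
        unfolding hausdorff_premeasure_def INF_less_iff by auto
      define W where "W i = U i \<inter> N" for i
      have bU: "bounded (U i)" "diameter (U i) \<le> 1" for i
        using U(1) by (auto simp: hausdorff_cover_def)
      have diam_le: "diameter (W i) \<le> diameter (U i)" for i
        using bU by (intro diameter_subset) (auto simp: W_def)
      have "\<exists>V. V \<in> sets borel \<and> (\<Union>t\<in>{0..T}. (*\<^sub>R) t ` W i) \<subseteq> V \<and>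
          emeasure lborel V \<le> ennreal K * hausdorff_cost ?d (W i)" for i
        unfolding K_def
        by (rule truncated_cone_cover[OF dim, of "W i" R T])
           (use R(1) T diam_le[of i] bU(2)[of i] in \<open>auto simp: W_def intro: order_trans\<close>)
      then obtain V where V: "\<And>i. V i \<in> sets borel" "\<And>i. (\<Union>t\<in>{0..T}. (*\<^sub>R) t ` W i) \<subseteq> V i"
          "\<And>i. emeasure lborel (V i) \<le> ennreal K * hausdorff_cost ?d (W i)"
        by metis
      have cost_le: "hausdorff_cost ?d (W i) \<le> hausdorff_cost ?d (U i)" for i
      proof (cases "W i = {}")
        case True then show ?thesis by (simp add: hausdorff_cost_def)
      next
        case False
        moreover have "0 \<le> diameter (W i)"
          using bU(1) by (intro diameter_ge_0) (auto simp: W_def)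
        ultimately show ?thesis
          using diam_le[of i] by (auto simp: hausdorff_cost_def W_def intro!: ennreal_leI mult_left_mono power_mono)
      qed
      have "emeasure lborel (\<Union>i. V i) \<le> (\<Sum>i. emeasure lborel (V i))"
        using V(1) by (intro emeasure_subadditive_countably) auto
      also have "\<dots> \<le> (\<Sum>i. ennreal K * hausdorff_cost ?d (U i))"
        by (intro suminf_le allI order_trans[OF V(3)] mult_left_mono cost_le) auto
      also have "\<dots> = ennreal K * (\<Sum>i. hausdorff_cost ?d (U i))"
        by simp
      also have "\<dots> \<le> ennreal K * ennreal (e / (2 * K))"
        using U(2) by (intro mult_left_mono) auto
      also have "\<dots> = ennreal (e / 2)"
        using K e by (simp flip: ennreal_mult)
      finally have small: "emeasure lborel (\<Union>i. V i) \<le> ennreal (e / 2)" .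
      have Vb: "(\<Union>i. V i) \<in> sets borel" using V(1) by auto
      have small': "emeasure lebesgue (\<Union>i. V i) \<le> ennreal (e / 2)"
        using small Vb by simp
      have fm: "(\<Union>i. V i) \<in> lmeasurable"
        using Vb small' by (intro fmeasurableI) (auto intro: le_less_trans)
      have "measure lebesgue (\<Union>i. V i) \<le> e / 2"
        using small' fm e by (simp add: emeasure_eq_measure2)
      moreover have "?C \<subseteq> (\<Union>i. V i)"
      proof
        fix y assume "y \<in> ?C"
        then obtain t x where t: "t \<in> {0..T}" "x \<in> N" "y = t *\<^sub>R x" by (auto simp: T_def)
        then obtain i where "x \<in> W i" using U(1) by (auto simp: hausdorff_cover_def W_def)
        then have "y \<in> V i" using V(2)[of i] t by blast
        then show "y \<in> (\<Union>i. V i)" by blast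
      qed
      ultimately show "\<exists>T. ?C \<subseteq> T \<and> T \<in> lmeasurable \<and> measure lebesgue T < e"
        using fm e by (intro exI[of _ "\<Union>i. V i"]) auto
    qed
  qed
  then have "negligible (\<Union>n. \<Union>t\<in>{0..real (Suc n)}. (*\<^sub>R) t ` N)"
    by (rule negligible_Union_nat)
  moreover have "(\<Union>t\<in>{0..}. (*\<^sub>R) t ` N) \<subseteq> (\<Union>n. \<Union>t\<in>{0..real (Suc n)}. (*\<^sub>R) t ` N)"
  proof clarsimp
    fix t :: real and x assume "0 \<le> t" "x \<in> N"
    moreover obtain n where "t \<le> real n" using real_arch_simple by blast
    ultimately show "\<exists>n. \<exists>s\<in>{0..1 + real n}. t *\<^sub>R x \<in> (*\<^sub>R) s ` N"
      by (intro exI[of _ n] bexI[of _ t]) auto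
  qed
  ultimately show ?thesis by (rule negligible_subset)
qed

section \<open>Lines meeting a negligible set in a negligible set\<close>

text \<open>Fubini for the pair of a translation and a parameter on the line.\<close>

lemma exists_negligible_line_section:
  fixes C :: "'a::euclidean_space set"
  assumes C: "negligible C" and V: "open V" "V \<noteq> {}"
  obtains y where "y \<in> V" "negligible {s. y + s *\<^sub>R w \<in> C}"
proof -
  obtain C' where C': "C \<subseteq> C'" "C' \<in> null_sets lborel"
    using C unfolding negligible_iff_null_sets null_sets_completion_iff2 by auto
  have C'_borel: "C' \<in> sets borel" using C'(2) by auto
  have C'_neg: "negligible C'"
    using C'(2) by (simp add: negligible_iff_null_sets null_sets_completionI)
  
  have "AE s in lborel. AE y in lborel. y + s *\<^sub>R w \<notin> C'"
  proof (rule AE_I2)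
    fix s :: real
    have "{y. y + s *\<^sub>R w \<in> C'} = (+) (- s *\<^sub>R w) ` C'"
      by (auto simp: image_iff algebra_simps)
    then have "negligible {y. y + s *\<^sub>R w \<in> C'}"
      using C'_neg negligible_translation by metis
    moreover have "{y. y + s *\<^sub>R w \<in> C'} \<in> sets borel"
      using C'_borel by measurable
    ultimately have "{y. y + s *\<^sub>R w \<in> C'} \<in> null_sets lborel"
      by (simp add: negligible_iff_null_sets null_sets_completion_iff)
    then show "AE y in lborel. y + s *\<^sub>R w \<notin> C'"
      by (rule AE_I') auto
  qed
  then have "AE y in lborel. AE s in lborel. y + s *\<^sub>R w \<notin> C'"
    by (subst lborel_pair.AE_commute) (use C'_borel in measurable)
  then obtain B where B: "{y. \<not> (AE s in lborel. y + s *\<^sub>R w \<notin> C')} \<subseteq> B" "B \<in> null_sets lborel"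
    by (auto elim!: AE_E simp: null_sets_def)
  have "negligible B"
    using B(2) by (simp add: negligible_iff_null_sets null_sets_completionI)
  then have "\<not> V \<subseteq> B"
    using V open_not_negligible negligible_subset by blast
  then obtain y where y: "y \<in> V" "AE s in lborel. y + s *\<^sub>R w \<notin> C'"
    using B by auto
  have "{s. y + s *\<^sub>R w \<in> C'} \<in> sets borel"
    using C'_borel by measurable
  then have "{s. y + s *\<^sub>R w \<in> C'} \<in> null_sets lborel"
    using y(2) by (subst AE_iff_null_sets) auto
  then have "negligible {s. y + s *\<^sub>R w \<in> C'}"
    by (simp add: negligible_iff_null_sets null_sets_completionI)
  then have "negligible {s. y + s *\<^sub>R w \<in> C}"
    by (rule negligible_subset) (use C' in auto)
  with y(1) show thesis by (rule that)
qed

section \<open>Trigonometric estimates\<close>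

text \<open>For \<open>r = L sin \<beta>\<close> and \<open>s = L sin \<gamma>\<close>, the left-hand side times \<open>L\<^sup>2\<close> is the squared distance of
  the points with polar coordinates \<open>(r, 0)\<close> and \<open>(s, \<theta>)\<close>, and the right-hand side times \<open>L\<^sup>2\<close> is the
  squared chord of the angle \<open>\<theta>\<close> on the circle of radius \<open>L\<close>.\<close>

lemma sin_diff_le_of_angle_le:
  fixes \<beta> \<gamma> \<theta> :: real
  assumes "\<bar>\<beta> - \<gamma>\<bar> \<le> \<theta>" "\<theta> \<le> pi"
  shows "(sin \<beta> - sin \<gamma>)\<^sup>2 + 2 * (sin \<beta> * sin \<gamma>) * (1 - cos \<theta>) \<le> 2 * (1 - cos \<theta>)"
proof -
  define Y where "Y = 1 - cos (\<beta> - \<gamma>)"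
  have "cos \<theta> \<le> cos \<bar>\<beta> - \<gamma>\<bar>"
    using assms by (intro cos_monotone_0_pi_le) auto
  then have XY: "Y \<le> 1 - cos \<theta>" by (simp add: Y_def)
  \<comment> \<open>For \<open>\<theta> = \<bar>\<beta> - \<gamma>\<bar>\<close> the two sides differ by exactly \<open>Y\<^sup>2\<close>.\<close>
  have "2 * Y * (1 - sin \<beta> * sin \<gamma>) - (sin \<beta> - sin \<gamma>)\<^sup>2 - Y\<^sup>2
     = 1 + (sin \<beta>)\<^sup>2 * (sin \<gamma>)\<^sup>2 - (cos \<beta>)\<^sup>2 * (cos \<gamma>)\<^sup>2 - (sin \<beta>)\<^sup>2 - (sin \<gamma>)\<^sup>2"
    unfolding Y_def cos_diff by algebra
  also have "\<dots> = 0"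
    unfolding cos_squared_eq by algebra
  finally have "(sin \<beta> - sin \<gamma>)\<^sup>2 \<le> 2 * Y * (1 - sin \<beta> * sin \<gamma>)"
    using zero_le_power2[of Y] by linarith
  also have "\<dots> \<le> 2 * (1 - cos \<theta>) * (1 - sin \<beta> * sin \<gamma>)"
  proof (intro mult_right_mono)
    have "\<bar>sin \<beta> * sin \<gamma>\<bar> \<le> 1"
      unfolding abs_mult by (intro mult_le_one) auto
    then show "0 \<le> 1 - sin \<beta> * sin \<gamma>" by linarith
  qed (use XY in auto)
  finally show ?thesis by (simp add: algebra_simps)
qed

lemma abs_arcsin_diff_le:
  fixes p q m L :: real
  assumes "0 \<le> p" "p \<le> m" "0 \<le> q" "q \<le> m" "m < L"
  shows "\<bar>arcsin (p / L) - arcsin (q / L)\<bar> \<le> \<bar>p - q\<bar> / sqrt (L\<^sup>2 - m\<^sup>2)"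
proof -
  have L: "0 < L" "0 \<le> m" using assms by auto
  have "m\<^sup>2 < L\<^sup>2" using assms L by (intro power_strict_mono) auto
  have "norm (arcsin (p / L) - arcsin (q / L)) \<le> 1 / sqrt (L\<^sup>2 - m\<^sup>2) * norm (p - q)"
  proof (rule field_differentiable_bound[where S = "{0..m}" and f' = "\<lambda>t. inverse (sqrt (1 - (t / L)\<^sup>2)) * (1 / L)"])
    fix t assume t: "t \<in> {0..m}"
    have tL: "0 \<le> t" "t < L" using t assms by auto
    have "-1 < t / L" "t / L < 1" using tL L by (auto intro: less_le_trans[of _ 0])
    then have tL2: "(t / L)\<^sup>2 < 1" by (simp add: abs_square_less_1)
    from \<open>-1 < t / L\<close> \<open>t / L < 1\<close> have "DERIV arcsin (t / L) :> inverse (sqrt (1 - (t / L)\<^sup>2))"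
      by (rule DERIV_arcsin)
    moreover have "((\<lambda>t. t / L) has_field_derivative 1 / L) (at t within {0..m})"
      by (rule DERIV_cdivide[OF DERIV_ident])
    ultimately show "((\<lambda>t. arcsin (t / L)) has_field_derivative inverse (sqrt (1 - (t / L)\<^sup>2)) * (1 / L)) (at t within {0..m})"
      by (rule DERIV_chain2)
    have "sqrt (L\<^sup>2 - m\<^sup>2) \<le> sqrt (L\<^sup>2 - t\<^sup>2)"
      using t by (intro real_sqrt_le_mono diff_left_mono power_mono) auto
    also have "\<dots> = sqrt (1 - (t / L)\<^sup>2) * L"
    proof -
      have "L\<^sup>2 - t\<^sup>2 = (1 - (t / L)\<^sup>2) * L\<^sup>2" using L by (simp add: field_simps)
      then show ?thesis using L by (simp only: real_sqrt_mult) simp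
    qed
    finally have "1 / (sqrt (1 - (t / L)\<^sup>2) * L) \<le> 1 / sqrt (L\<^sup>2 - m\<^sup>2)"
      using \<open>m\<^sup>2 < L\<^sup>2\<close> tL2 L by (intro divide_left_mono mult_pos_pos) auto
    then show "norm (inverse (sqrt (1 - (t / L)\<^sup>2)) * (1 / L)) \<le> 1 / sqrt (L\<^sup>2 - m\<^sup>2)"
      using L tL2 by (simp add: abs_mult inverse_eq_divide)
  qed (use assms in auto)
  then show ?thesis by simp
qed

lemma norm_diff_scaleR_unit:
  fixes z u :: "'a::real_inner"
  assumes "norm z = 1" "norm u = 1"
  shows "(norm (a *\<^sub>R z - b *\<^sub>R u))\<^sup>2 = (a - b)\<^sup>2 + a * b * (norm (z - u))\<^sup>2"
proof -
  have "z \<bullet> z = 1" "u \<bullet> u = 1"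
    using assms by (simp_all add: norm_eq_1)
  then show ?thesis
    unfolding power2_norm_eq_inner
    by (simp add: inner_diff_left inner_diff_right inner_commute[of u z] power2_eq_square algebra_simps)
qed

lemma segment_angle_bounds:
  "0 \<le> segment_angle z x" "segment_angle z x \<le> pi / 2"
  "cos (segment_angle z x) = \<bar>(z - x) \<bullet> x\<bar> / (norm (z - x) * norm x)"
proof -
  define c where "c = \<bar>(z - x) \<bullet> x\<bar> / (norm (z - x) * norm x)"
  have c: "0 \<le> c" "c \<le> 1"
    using Cauchy_Schwarz_ineq2[of "z - x" x] by (auto simp: c_def divide_le_eq_1 zero_less_mult_iff)
  then show "0 \<le> segment_angle z x" "segment_angle z x \<le> pi / 2"
    "cos (segment_angle z x) = \<bar>(z - x) \<bullet> x\<bar> / (norm (z - x) * norm x)"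
    unfolding segment_angle_def c_def[symmetric]
    using arccos_le_pi2[of c] by (auto intro: arccos_lbound)
qed

text \<open>Both sides are the height of the triangle with vertices \<open>0\<close>, \<open>b u\<close>, \<open>a z\<close> over the side
  \<open>[0, b u]\<close>: the chord \<open>d = \<bar>z - u\<bar>\<close> of an angle \<open>\<theta>\<close> satisfies \<open>sin \<theta> = d sqrt (1 - d\<^sup>2 / 4)\<close>.\<close>

lemma sin_segment_angle_mult_norm:
  fixes z u :: "'a::real_inner"
  assumes unit: "norm z = 1" "norm u = 1" and pos: "0 < a" "0 < b" and ne: "a *\<^sub>R z \<noteq> b *\<^sub>R u"
  shows "sin (segment_angle (a *\<^sub>R z) (b *\<^sub>R u)) * norm (a *\<^sub>R z - b *\<^sub>R u)
       = a * norm (z - u) * sqrt (1 - (norm (z - u))\<^sup>2 / 4)"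
proof (rule power2_eq_imp_eq)
  let ?s = "segment_angle (a *\<^sub>R z) (b *\<^sub>R u)" and ?n = "norm (a *\<^sub>R z - b *\<^sub>R u)"
  define k where "k = z \<bullet> u"
  have zu: "z \<bullet> z = 1" "u \<bullet> u = 1" "z \<bullet> u = k" "u \<bullet> z = k"
    using unit by (simp_all add: norm_eq_1 k_def inner_commute)
  have n: "?n\<^sup>2 = a\<^sup>2 - 2 * a * b * k + b\<^sup>2"
    unfolding power2_norm_eq_inner by (simp add: inner_diff_left inner_diff_right zu power2_eq_square algebra_simps)
  have d: "(norm (z - u))\<^sup>2 = 2 - 2 * k"
    unfolding power2_norm_eq_inner by (simp add: inner_diff_left inner_diff_right zu)
  have "\<bar>k\<bar> \<le> 1"
    using Cauchy_Schwarz_ineq2[of z u] unit by (simp add: k_def)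
  have "?n > 0" using ne by simp
  have "(a *\<^sub>R z - b *\<^sub>R u) \<bullet> (b *\<^sub>R u) = b * (a * k - b)"
    by (simp add: inner_diff_left zu)
  then have "cos ?s * ?n = \<bar>a * k - b\<bar>"
    using \<open>?n > 0\<close> pos(2) unit(2) by (simp add: segment_angle_bounds(3) abs_mult)
  then have "(cos ?s)\<^sup>2 * ?n\<^sup>2 = (a * k - b)\<^sup>2"
    by (metis power_mult_distrib power2_abs)
  then have "(sin ?s * ?n)\<^sup>2 = ?n\<^sup>2 - (a * k - b)\<^sup>2"
    by (simp add: power_mult_distrib sin_squared_eq left_diff_distrib)
  also have "\<dots> = a\<^sup>2 * ((2 - 2 * k) * (1 - (2 - 2 * k) / 4))"
    unfolding n by (simp add: field_simps power2_eq_square)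
  also have "\<dots> = (a * norm (z - u) * sqrt (1 - (norm (z - u))\<^sup>2 / 4))\<^sup>2"
    using \<open>\<bar>k\<bar> \<le> 1\<close> by (simp add: power_mult_distrib d)
  finally show "(sin ?s * ?n)\<^sup>2 = (a * norm (z - u) * sqrt (1 - (norm (z - u))\<^sup>2 / 4))\<^sup>2" .
  show "0 \<le> sin ?s * ?n"
    using segment_angle_bounds[of "a *\<^sub>R z" "b *\<^sub>R u"] by (intro mult_nonneg_nonneg sin_ge_zero) auto
  show "0 \<le> a * norm (z - u) * sqrt (1 - (norm (z - u))\<^sup>2 / 4)"
    using \<open>\<bar>k\<bar> \<le> 1\<close> pos by (simp add: d)
qed

section \<open>Measurability of the tangent angle\<close>

text \<open>A countable supremum suffices, so that the lower limit is measurable as soon as the infima over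
  punctured balls of a fixed radius are.\<close>

lemma Liminf_at_within_eq_SUP:
  fixes f :: "'a::metric_space \<Rightarrow> 'b::complete_lattice"
  shows "Liminf (at x within X) f = (SUP n. INF y\<in>X \<inter> ball x (1 / real (Suc n)) - {x}. f y)"
  unfolding Liminf_within
proof (rule antisym)
  show "(SUP e\<in>{0<..}. INF y\<in>X \<inter> ball x e - {x}. f y) \<le> (SUP n. INF y\<in>X \<inter> ball x (1 / real (Suc n)) - {x}. f y)"
  proof (rule SUP_least)
    fix e :: real assume "e \<in> {0<..}"
    then obtain n where n: "1 / real (Suc n) < e" using nat_approx_posE by auto
    have "(INF y\<in>X \<inter> ball x e - {x}. f y) \<le> (INF y\<in>X \<inter> ball x (1 / real (Suc n)) - {x}. f y)"
      using n by (intro INF_superset_mono) auto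
    also have "\<dots> \<le> (SUP n. INF y\<in>X \<inter> ball x (1 / real (Suc n)) - {x}. f y)"
      by (rule SUP_upper) simp
    finally show "(INF y\<in>X \<inter> ball x e - {x}. f y) \<le> (SUP n. INF y\<in>X \<inter> ball x (1 / real (Suc n)) - {x}. f y)" .
  qed
  show "(SUP n. INF y\<in>X \<inter> ball x (1 / real (Suc n)) - {x}. f y) \<le> (SUP e\<in>{0<..}. INF y\<in>X \<inter> ball x e - {x}. f y)"
    by (rule SUP_least, rule SUP_upper) simp
qed

lemma borel_measurable_tangent_angle:
  fixes X :: "'a::euclidean_space set"
  assumes X: "X \<in> sets borel" "0 \<notin> X"
  shows "tangent_angle X \<in> borel_measurable (restrict_space borel X)"
proof -
  \<comment> \<open>For a fixed radius the infimum is upper semicontinuous on \<open>X\<close>, as the radius constraint is open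
    and the angle is continuous in \<open>x\<close> away from \<open>y\<close> and \<open>0\<close>.\<close>
  have open_slice: "\<exists>U. open U \<and> {x \<in> X. (INF y\<in>X \<inter> ball x r - {x}. ereal (segment_angle y x)) < c} = X \<inter> U" for r c
  proof -
    define U where "U y = {x \<in> ball y r - {y, 0}. ereal (segment_angle y x) < c}" for y :: 'a
    have "open (U y)" for y
    proof -
      have "continuous_on (ball y r - {y, 0}) (\<lambda>x. ereal (segment_angle y x))"
        unfolding segment_angle_def
        using Cauchy_Schwarz_ineq2[of "y - _" _]
        by (intro continuous_intros) (auto simp: divide_le_eq_1 zero_less_mult_iff intro: order_trans[of "-1" 0])
      moreover have "open (ball y r - {y, 0})" by (intro open_Diff) auto
      ultimately have "open ((ball y r - {y, 0}) \<inter> (\<lambda>x. ereal (segment_angle y x)) -` {..<c})"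
        by (intro continuous_open_preimage) auto
      also have "(ball y r - {y, 0}) \<inter> (\<lambda>x. ereal (segment_angle y x)) -` {..<c} = U y"
        by (auto simp: U_def)
      finally show ?thesis .
    qed
    moreover have "{x \<in> X. (INF y\<in>X \<inter> ball x r - {x}. ereal (segment_angle y x)) < c} = X \<inter> (\<Union>y\<in>X. U y)"
      using X(2) by (auto simp: INF_less_iff U_def dist_commute)
    ultimately show ?thesis by blast
  qed
  have "(\<lambda>x. INF y\<in>X \<inter> ball x r - {x}. ereal (segment_angle y x)) \<in> borel_measurable (restrict_space borel X)" for r
  proof (rule borel_measurableI_less)
    fix c :: ereal
    obtain U where U: "open U" "{x \<in> X. (INF y\<in>X \<inter> ball x r - {x}. ereal (segment_angle y x)) < c} = X \<inter> U"
      using open_slice by blast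
    have "X \<inter> U \<in> sets (restrict_space borel X)"
      using U(1) by (auto simp: sets_restrict_space)
    then show "{x \<in> space (restrict_space borel X). (INF y\<in>X \<inter> ball x r - {x}. ereal (segment_angle y x)) < c}
        \<in> sets (restrict_space borel X)"
      using U(2) by (simp add: space_restrict_space)
  qed
  then show ?thesis
    unfolding tangent_angle_def[abs_def] Liminf_at_within_eq_SUP
    by (intro borel_measurable_real_of_ereal borel_measurable_SUP) auto
qed

section \<open>The radial homeomorphism\<close>

lemma homeomorphism_filterlim_at:
  assumes h: "homeomorphism X Y f g" and x: "x \<in> X"
  shows "filterlim f (at (f x) within Y) (at x within X)"
  unfolding filterlim_at
proof
  show "(f \<longlongrightarrow> f x) (at x within X)"
    using h x by (simp add: homeomorphism_def continuous_on_def)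
  show "\<forall>\<^sub>F y in at x within X. f y \<in> Y \<and> f y \<noteq> f x"
    using h x unfolding eventually_at_filter homeomorphism_def
    by (intro always_eventually) (metis imageI)
qed

text \<open>A bounded open set that is strictly starlike with respect to \<open>0\<close>, in dimension at least \<open>2\<close>.\<close>

locale starlike_domain =
  fixes D :: "'a::euclidean_space set"
  assumes bounded_D: "bounded D" and open_D: "open D"
    and starlike: "strictly_starlike 0 D" and dim: "2 \<le> DIM('a)"
begin

abbreviation M where "M \<equiv> frontier D"
abbreviation S where "S \<equiv> sphere (0::'a) 1"
abbreviation phi ("\<phi>") where "\<phi> \<equiv> radial_map D"
abbreviation rho ("\<rho>") where "\<rho> u \<equiv> norm (\<phi> u)"
abbreviation angle ("\<alpha>") where "\<alpha> \<equiv> tangent_angle M"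

lemma compact_M: "compact M"
  using bounded_D by (rule compact_frontier_bounded)

lemma zero_notin_M: "0 \<notin> M"
  using starlike open_D by (auto simp: strictly_starlike_def frontier_def interior_open)

lemma phi_in_M: "u \<in> S \<Longrightarrow> \<phi> u \<in> M"
  and phi_eq: "u \<in> S \<Longrightarrow> \<phi> u = \<rho> u *\<^sub>R u"
proof -
  assume u: "u \<in> S"
  then have "\<exists>!x. x \<in> ray 0 u \<inter> M" using starlike by (auto simp: strictly_starlike_def)
  from theI'[OF this] have *: "\<phi> u \<in> ray 0 u \<inter> M" by (simp add: radial_map_def)
  then show "\<phi> u \<in> M" by simp
  from * obtain t where "0 \<le> t" "\<phi> u = t *\<^sub>R u" by (auto simp: ray_def)
  then show "\<phi> u = \<rho> u *\<^sub>R u" using u by simp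
qed

lemma rho_pos: "u \<in> S \<Longrightarrow> 0 < \<rho> u"
  using phi_in_M[of u] zero_notin_M by (cases "\<phi> u = 0") auto

lemma sgn_phi: "u \<in> S \<Longrightarrow> sgn (\<phi> u) = u"
proof -
  assume u: "u \<in> S"
  have "sgn u = u" unfolding sgn_div_norm using u by simp
  then have "sgn (\<rho> u *\<^sub>R u) = u"
    using rho_pos[OF u] by (simp only: sgn_scaleR) simp
  then show "sgn (\<phi> u) = u" by (simp only: phi_eq[OF u, symmetric])
qed

lemma sgn_in_S: "x \<noteq> 0 \<Longrightarrow> sgn x \<in> S"
  by (simp only: mem_sphere_0 norm_sgn) simp

lemma sgn_boundary_in_S: "x \<in> M \<Longrightarrow> sgn x \<in> S"
  by (rule sgn_in_S) (use zero_notin_M in metis)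

lemma phi_sgn:
  assumes x: "x \<in> M"
  shows "\<phi> (sgn x) = x"
proof -
  have u: "sgn x \<in> S" using x by (rule sgn_boundary_in_S)
  have x_eq: "x = 0 + norm x *\<^sub>R sgn x" by (cases "x = 0") (simp_all add: sgn_div_norm)
  have "x \<in> ray 0 (sgn x)"
    unfolding ray_def mem_Collect_eq
    by (rule exI[of _ "norm x"], rule conjI, rule x_eq, rule norm_ge_zero)
  then have mem: "x \<in> ray 0 (sgn x) \<inter> M"
    using x by (rule IntI)
  have ex: "\<exists>!y. y \<in> ray 0 (sgn x) \<inter> M"
    using starlike u by (auto simp: strictly_starlike_def)
  show ?thesis
    unfolding radial_map_def by (rule the1_equality[OF ex mem])
qed

lemma phi_eq_iff: "z \<in> S \<Longrightarrow> u \<in> S \<Longrightarrow> \<phi> z = \<phi> u \<longleftrightarrow> z = u"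
  using sgn_phi by metis

lemma homeomorphism_sgn: "homeomorphism M S sgn \<phi>"
proof -
  have cont: "continuous_on M sgn"
    unfolding sgn_div_norm[abs_def] using zero_notin_M by (auto intro!: continuous_intros)
  have img: "sgn ` M = S"
  proof
    show "sgn ` M \<subseteq> S" using sgn_boundary_in_S by blast
    show "S \<subseteq> sgn ` M" using sgn_phi phi_in_M by (metis image_eqI subsetI)
  qed
  have inj: "inj_on sgn M"
    using phi_sgn by (metis inj_onI)
  obtain g where g: "homeomorphism M S sgn g"
    using homeomorphism_compact[OF compact_M cont img inj] by blast
  have "\<phi> y = g y" if "y \<in> S" for y
  proof -
    have "g y \<in> M" "sgn (g y) = y" using g that by (auto simp: homeomorphism_def simp del: mem_sphere_0)
    then show ?thesis using phi_sgn[of "g y"] by simp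
  qed
  then show ?thesis by (intro homeomorphism_cong[OF g]) auto
qed

lemmas homeomorphism_phi = homeomorphism_symD[OF homeomorphism_sgn]

lemma continuous_phi: "continuous_on S \<phi>"
  using homeomorphism_phi by (simp add: homeomorphism_def)

lemma inv_phi: "x \<in> M \<Longrightarrow> inv_into S \<phi> x = sgn x"
  by (rule inv_into_f_eq[OF inj_onI]) (auto simp: phi_eq_iff phi_sgn sgn_boundary_in_S simp del: mem_sphere mem_sphere_0)

lemma homeomorphism_inv_into: "homeomorphism S M \<phi> (inv_into S \<phi>)"
  using homeomorphism_phi by (rule homeomorphism_cong) (auto simp: inv_phi)

lemma ex_unit: "\<exists>u. u \<in> S"
proof -
  obtain b :: 'a where "b \<in> Basis" using nonempty_Basis by blast
  then show ?thesis by (intro exI[of _ b]) simp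
qed

lemma M_nonempty: "M \<noteq> {}"
  using ex_unit phi_in_M by blast

lemma dist_phi_sq:
  "z \<in> S \<Longrightarrow> u \<in> S \<Longrightarrow>
    (norm (\<phi> z - \<phi> u))\<^sup>2 = (\<rho> z - \<rho> u)\<^sup>2 + \<rho> z * \<rho> u * (norm (z - u))\<^sup>2"
  using norm_diff_scaleR_unit[of z u "\<rho> z" "\<rho> u"] by (simp flip: phi_eq)

lemma sin_segment_angle_phi:
  "z \<in> S \<Longrightarrow> u \<in> S \<Longrightarrow> z \<noteq> u \<Longrightarrow>
    sin (segment_angle (\<phi> z) (\<phi> u)) * norm (\<phi> z - \<phi> u)
      = \<rho> z * norm (z - u) * sqrt (1 - (norm (z - u))\<^sup>2 / 4)"
  using sin_segment_angle_mult_norm[of z u "\<rho> z" "\<rho> u"] rho_pos[of z] rho_pos[of u] phi_eq_iff[of z u]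
  by (simp flip: phi_eq)

lemma at_S_nontrivial: "u \<in> S \<Longrightarrow> at u within S \<noteq> bot"
proof -
  assume u: "u \<in> S"
  have "u \<noteq> 0" and mem: "- u \<in> S" using u by auto
  have "- u \<noteq> u"
  proof
    assume "- u = u"
    then have "2 *\<^sub>R u = 0" unfolding scaleR_2 by (metis add.right_inverse)
    then show False using \<open>u \<noteq> 0\<close> by simp
  qed
  then have "S \<noteq> {x}" for x using u mem by (metis singletonD)
  then have "u islimpt S"
    using u dim by (intro connected_imp_perfect connected_sphere) auto
  then show ?thesis by (simp add: trivial_limit_within)
qed

lemma filterlim_phi: "u \<in> S \<Longrightarrow> filterlim \<phi> (at (\<phi> u) within M) (at u within S)"
  by (rule homeomorphism_filterlim_at[OF homeomorphism_phi])

lemma at_M_nontrivial: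
  assumes x: "x \<in> M" shows "at x within M \<noteq> bot"
  using filterlim_phi[of "sgn x"] at_S_nontrivial[of "sgn x"] x sgn_boundary_in_S
  unfolding filterlim_def phi_sgn[OF x] by (metis bot.extremum_uniqueI filtermap_bot_iff)

section \<open>The tangent angle and the local dilatation\<close>

text \<open>No point of \<open>M\<close> is isolated, so that the lower limit is finite and the conversion to a real
  number in the definition of the tangent angle loses nothing.\<close>

lemma Liminf_segment_angle:
  assumes x: "x \<in> M"
  shows "Liminf (at x within M) (\<lambda>z. ereal (segment_angle z x)) = ereal (\<alpha> x)"
    and "0 \<le> \<alpha> x" and "\<alpha> x \<le> pi / 2"
proof -
  let ?L = "Liminf (at x within M) (\<lambda>z. ereal (segment_angle z x))"
  have 1: "ereal 0 \<le> ?L"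
    by (intro Liminf_bounded always_eventually) (auto simp: segment_angle_bounds)
  have 2: "?L \<le> ereal (pi / 2)"
    by (intro Liminf_le[OF at_M_nontrivial[OF x]] always_eventually allI)
       (simp only: ereal_less_eq segment_angle_bounds(2))
  show L: "?L = ereal (\<alpha> x)"
    using 1 2 unfolding tangent_angle_def by (intro ereal_real'[symmetric]) auto
  show "0 \<le> \<alpha> x" "\<alpha> x \<le> pi / 2"
    using 1 2 unfolding L by auto
qed

lemma sin_angle_nonneg: "x \<in> M \<Longrightarrow> 0 \<le> sin (\<alpha> x)"
  using Liminf_segment_angle(2,3)[of x] by (intro sin_ge_zero) auto

lemma rho_tendsto: "u \<in> S \<Longrightarrow> (\<rho> \<longlongrightarrow> \<rho> u) (at u within S)"
  using continuous_phi by (auto simp: continuous_on_def intro!: tendsto_norm)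

text \<open>The local dilatation of \<open>\<phi>\<close> at \<open>u\<close> is at most \<open>\<bar>x\<bar> / sin \<alpha>(x)\<close> for \<open>x = \<phi>(u)\<close>.\<close>

lemma eventually_dist_phi_le:
  assumes u: "u \<in> S" and K: "0 < K" "\<rho> u < K * sin (\<alpha> (\<phi> u))"
  shows "\<forall>\<^sub>F z in at u within S. norm (\<phi> z - \<phi> u) \<le> K * norm (z - u)"
proof -
  let ?a = "\<alpha> (\<phi> u)"
  note a = Liminf_segment_angle[OF phi_in_M[OF u]]
  have "\<rho> u / K < sin ?a" using K by (simp add: field_simps)
  then obtain c where c: "\<rho> u / K < c" "c < sin ?a" by (metis dense)
  have "0 < c" using c(1) rho_pos[OF u] K(1) by (smt (verit) divide_pos_pos)
  have "c \<le> 1" using c(2) sin_le_one[of ?a] by linarith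
  have "arcsin c < arcsin (sin ?a)"
    using c \<open>0 < c\<close> by (intro arcsin_less_arcsin) auto
  also have "\<dots> = ?a" using a by (intro arcsin_sin) auto
  finally have "ereal (arcsin c) < Liminf (at (\<phi> u) within M) (\<lambda>z. ereal (segment_angle z (\<phi> u)))"
    unfolding a(1) by simp
  from less_LiminfD[OF this]
  have "\<forall>\<^sub>F z in at (\<phi> u) within M. arcsin c < segment_angle z (\<phi> u)" by simp
  then have 1: "\<forall>\<^sub>F z in at u within S. arcsin c < segment_angle (\<phi> z) (\<phi> u)"
    using filterlim_phi[OF u] by (auto simp: filterlim_iff)
  have "\<rho> u < c * K" using c(1) K(1) by (simp add: field_simps)
  then have 2: "\<forall>\<^sub>F z in at u within S. \<rho> z < c * K"
    using rho_tendsto[OF u] by (rule order_tendstoD(2)[rotated])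
  have 3: "\<forall>\<^sub>F z in at u within S. z \<in> S \<and> z \<noteq> u"
    by (simp add: eventually_at_filter)
  show ?thesis
    using 1 2 3
  proof eventually_elim
    case (elim z)
    let ?s = "segment_angle (\<phi> z) (\<phi> u)"
    have "sin (arcsin c) \<le> sin ?s"
      using elim(1) \<open>0 < c\<close> \<open>c \<le> 1\<close> segment_angle_bounds[of "\<phi> z" "\<phi> u"]
      by (intro sin_monotone_2pi_le) (auto intro: order_trans[OF _ arcsin_nonneg])
    then have "c \<le> sin ?s" using \<open>0 < c\<close> \<open>c \<le> 1\<close> by simp
    then have "c * norm (\<phi> z - \<phi> u) \<le> sin ?s * norm (\<phi> z - \<phi> u)"
      by (intro mult_right_mono) auto
    also have "\<dots> = \<rho> z * norm (z - u) * sqrt (1 - (norm (z - u))\<^sup>2 / 4)"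
      using sin_segment_angle_phi elim(3) u by blast
    also have "\<dots> \<le> \<rho> z * norm (z - u) * 1"
      by (intro mult_left_mono) auto
    also have "\<dots> \<le> c * (K * norm (z - u))"
      using elim(2) mult_right_mono[of "\<rho> z" "c * K" "norm (z - u)"] by (simp add: mult_ac)
    finally show ?case using \<open>0 < c\<close> by simp
  qed
qed

text \<open>The converse: a local Lipschitz constant at \<open>u\<close> bounds \<open>\<bar>x\<bar> / sin \<alpha>(x)\<close> from above. In particular
  \<open>\<alpha>(x)\<close> is then positive.\<close>

lemma rho_le_mult_sin_angle:
  assumes u: "u \<in> S" and ev: "\<forall>\<^sub>F z in at u within S. norm (\<phi> z - \<phi> u) \<le> K * norm (z - u)"
  shows "\<rho> u \<le> K * sin (\<alpha> (\<phi> u))"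
proof -
  let ?a = "\<alpha> (\<phi> u)"
  note a = Liminf_segment_angle[OF phi_in_M[OF u]]
  have ev_S: "\<forall>\<^sub>F z in at u within S. z \<in> S \<and> z \<noteq> u"
    by (simp add: eventually_at_filter)
  obtain z0 where z0: "z0 \<in> S" "z0 \<noteq> u" "norm (\<phi> z0 - \<phi> u) \<le> K * norm (z0 - u)"
    using eventually_happens'[OF at_S_nontrivial[OF u] eventually_conj[OF ev ev_S]] by auto
  have "0 < norm (\<phi> z0 - \<phi> u)" using phi_eq_iff z0 u by simp
  then have "0 < K * norm (z0 - u)" using z0(3) by linarith
  then have K: "0 < K" using norm_ge_zero[of "z0 - u"] by (simp add: zero_less_mult_iff)
  show ?thesis
  proof (rule dense_le)
    fix c assume c: "c < \<rho> u"
    show "c \<le> K * sin ?a"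
    proof (cases "c \<le> 0")
      case True
      moreover have "0 \<le> K * sin ?a"
        using sin_angle_nonneg[OF phi_in_M[OF u]] K by simp
      ultimately show ?thesis by linarith
    next
      case False
      have "((\<lambda>z. \<rho> z * sqrt (1 - (norm (z - u))\<^sup>2 / 4)) \<longlongrightarrow> \<rho> u * sqrt (1 - (norm (u - u))\<^sup>2 / 4)) (at u within S)"
        by (rule tendsto_mult[OF rho_tendsto[OF u]], intro tendsto_intros) simp
      then have "\<forall>\<^sub>F z in at u within S. c < \<rho> z * sqrt (1 - (norm (z - u))\<^sup>2 / 4)"
        using c by (intro order_tendstoD) auto
      with ev ev_S have sin_ge: "\<forall>\<^sub>F z in at u within S. c / K \<le> sin (segment_angle (\<phi> z) (\<phi> u))"
      proof eventually_elim
        case (elim z)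
        let ?s = "segment_angle (\<phi> z) (\<phi> u)"
        have s: "0 \<le> sin ?s"
          using segment_angle_bounds[of "\<phi> z" "\<phi> u"] by (intro sin_ge_zero) auto
        have "c * norm (z - u) \<le> (\<rho> z * sqrt (1 - (norm (z - u))\<^sup>2 / 4)) * norm (z - u)"
          using elim by (intro mult_right_mono) auto
        also have "\<dots> = sin ?s * norm (\<phi> z - \<phi> u)"
          using sin_segment_angle_phi[of z u] elim u by (simp add: mult_ac)
        also have "\<dots> \<le> sin ?s * (K * norm (z - u))"
          using elim s by (intro mult_left_mono) auto
        finally have "c * norm (z - u) \<le> (sin ?s * K) * norm (z - u)" by (simp add: mult_ac)
        then have "c \<le> sin ?s * K" using elim by simp
        then show ?case using K by (simp add: field_simps)
      qed
      have "c / K \<le> 1"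
      proof -
        obtain z where "c / K \<le> sin (segment_angle (\<phi> z) (\<phi> u))"
          using eventually_happens'[OF at_S_nontrivial[OF u] sin_ge] by auto
        then show ?thesis using sin_le_one[of "segment_angle (\<phi> z) (\<phi> u)"] by linarith
      qed
      have "0 < c / K" using False K by simp
      have "\<forall>\<^sub>F x in at (\<phi> u) within M. c / K \<le> sin (segment_angle x (\<phi> u))"
      proof -
        have "filterlim sgn (at u within S) (at (\<phi> u) within M)"
          using homeomorphism_filterlim_at[OF homeomorphism_sgn phi_in_M[OF u]] sgn_phi[OF u] by simp
        then have "\<forall>\<^sub>F x in at (\<phi> u) within M. c / K \<le> sin (segment_angle (\<phi> (sgn x)) (\<phi> u))"
          using sin_ge by (auto simp: filterlim_iff)
        moreover have "\<forall>\<^sub>F x in at (\<phi> u) within M. x \<in> M"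
          by (simp add: eventually_at_filter)
        ultimately show ?thesis by eventually_elim (simp add: phi_sgn)
      qed
      then have "\<forall>\<^sub>F x in at (\<phi> u) within M. ereal (arcsin (c / K)) \<le> ereal (segment_angle x (\<phi> u))"
      proof eventually_elim
        case (elim x)
        have "arcsin (c / K) \<le> arcsin (sin (segment_angle x (\<phi> u)))"
          using elim \<open>0 < c / K\<close> by (intro arcsin_le_arcsin) auto
        also have "\<dots> = segment_angle x (\<phi> u)"
          using segment_angle_bounds[of x "\<phi> u"] by (intro arcsin_sin) auto
        finally show ?case by simp
      qed
      from Liminf_bounded[OF this] have "arcsin (c / K) \<le> ?a"
        unfolding a(1) by simp
      then have "sin (arcsin (c / K)) \<le> sin ?a"
        using a \<open>0 < c / K\<close> \<open>c / K \<le> 1\<close> arcsin_lbound[of "c / K"]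
        by (intro sin_monotone_2pi_le) auto
      then have "c / K \<le> sin ?a" using \<open>0 < c / K\<close> \<open>c / K \<le> 1\<close> by simp
      then show ?thesis using K by (simp add: field_simps)
    qed
  qed
qed

section \<open>Lipschitz bounds from almost everywhere bounds\<close>

lemma continuous_on_phi_sgn: "continuous_on (- {0}) (\<lambda>x. \<phi> (sgn x))"
proof (rule continuous_on_compose2[OF continuous_phi])
  show "continuous_on (- {0::'a}) sgn"
    by (auto intro!: continuous_on_sgn continuous_on_id)
  show "sgn ` (- {0}) \<subseteq> S"
    using sgn_in_S by blast
qed

lemma arc_in_S:
  assumes "norm e1 = 1" "norm e2 = 1" "e1 \<bullet> e2 = 0"
  shows "cos t *\<^sub>R e1 + sin t *\<^sub>R e2 \<in> S"
proof -
  have "(norm (cos t *\<^sub>R e1 + sin t *\<^sub>R e2))\<^sup>2 = (cos t)\<^sup>2 + (sin t)\<^sup>2"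
    using assms unfolding power2_norm_eq_inner
    by (simp add: inner_add_left inner_add_right inner_commute[of e2 e1] norm_eq_1 power2_eq_square)
  then show ?thesis by (simp add: norm_eq_sqrt_inner power2_norm_eq_inner)
qed

lemma norm_arc_diff_sq:
  assumes "norm e1 = 1" "norm e2 = 1" "e1 \<bullet> e2 = 0"
  shows "(norm ((cos s *\<^sub>R e1 + sin s *\<^sub>R e2) - (cos t *\<^sub>R e1 + sin t *\<^sub>R e2)))\<^sup>2 = 2 * (1 - cos (s - t))"
proof -
  have "(norm ((cos s *\<^sub>R e1 + sin s *\<^sub>R e2) - (cos t *\<^sub>R e1 + sin t *\<^sub>R e2)))\<^sup>2
      = (cos s - cos t)\<^sup>2 + (sin s - sin t)\<^sup>2"
    using assms unfolding power2_norm_eq_inner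
    by (simp add: inner_add_left inner_add_right inner_diff_left inner_diff_right inner_commute[of e2 e1]
        norm_eq_1 power2_eq_square algebra_simps)
  also have "\<dots> = ((cos s)\<^sup>2 + (sin s)\<^sup>2) + ((cos t)\<^sup>2 + (sin t)\<^sup>2) - 2 * (cos s * cos t + sin s * sin t)"
    by (simp add: power2_diff del: sin_cos_squared_add sin_cos_squared_add2)
  finally show ?thesis by (simp add: cos_diff)
qed

lemma norm_arc_diff_le:
  assumes "norm e1 = 1" "norm e2 = 1" "e1 \<bullet> e2 = 0"
  shows "norm ((cos s *\<^sub>R e1 + sin s *\<^sub>R e2) - (cos t *\<^sub>R e1 + sin t *\<^sub>R e2)) \<le> \<bar>s - t\<bar>"
proof (rule power2_le_imp_le)
  have "1 - cos (s - t) = 2 * (sin ((s - t) / 2))\<^sup>2"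
    using cos_double_sin[of "(s - t) / 2"] by (simp only: mult_2 field_sum_of_halves)
  also have "\<dots> \<le> 2 * ((s - t) / 2)\<^sup>2"
    using power_mono[OF abs_sin_x_le_abs_x[of "(s - t) / 2"], of 2] by (simp only: power2_abs) simp
  finally show "(norm ((cos s *\<^sub>R e1 + sin s *\<^sub>R e2) - (cos t *\<^sub>R e1 + sin t *\<^sub>R e2)))\<^sup>2 \<le> \<bar>s - t\<bar>\<^sup>2"
    unfolding norm_arc_diff_sq[OF assms] by (simp add: power_divide)
qed simp

text \<open>The set where \<open>\<rho> > \<Lambda>\<close>, extended to be constant along open rays, is open and contained in the cone
  over the exceptional set \<open>N\<close>; hence it is empty.\<close>

lemma rho_le_of_ae_bound:
  assumes N: "N \<subseteq> M" "negligible (\<Union>t\<in>{0..}. (*\<^sub>R) t ` N)"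
    and good: "\<And>x. x \<in> M - N \<Longrightarrow> norm x \<le> \<Lambda> * sin (\<alpha> x)"
    and u: "u \<in> S"
  shows "\<rho> u \<le> \<Lambda>"
proof (rule ccontr)
  assume gt: "\<not> \<rho> u \<le> \<Lambda>"
  define V where "V = {x \<in> - {0}. norm (\<phi> (sgn x)) \<in> {\<Lambda><..}}"
  have "V = - {0} \<inter> (\<lambda>x. norm (\<phi> (sgn x))) -` {\<Lambda><..}"
    by (auto simp: V_def)
  then have "open V"
    using continuous_open_preimage[OF continuous_on_norm[OF continuous_on_phi_sgn] _ open_greaterThan, of \<Lambda>]
    by (simp add: open_Compl)
  moreover have "u \<in> V"
  proof -
    have "u \<noteq> 0" "sgn u = u" using u by (auto simp: sgn_div_norm)
    then show ?thesis using gt by (simp add: V_def)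
  qed
  moreover have "V \<subseteq> (\<Union>t\<in>{0..}. (*\<^sub>R) t ` N)"
  proof
    fix x assume x: "x \<in> V"
    define y where "y = \<phi> (sgn x)"
    have sx: "x \<noteq> 0" "sgn x \<in> S" using x sgn_in_S by (simp_all add: V_def del: mem_sphere_0)
    have y: "y \<in> M" "0 < norm y" "\<Lambda> < norm y" "y = norm y *\<^sub>R sgn x"
      using phi_in_M[OF sx(2)] rho_pos[OF sx(2)] x phi_eq[OF sx(2)] by (simp_all add: y_def V_def del: zero_less_norm_iff)
    have "y \<in> N"
    proof (rule ccontr)
      assume "y \<notin> N"
      then have le: "norm y \<le> \<Lambda> * sin (\<alpha> y)" using good y(1) by simp
      have "0 \<le> \<Lambda>"
      proof (rule ccontr)
        assume "\<not> 0 \<le> \<Lambda>"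
        then have "\<Lambda> * sin (\<alpha> y) \<le> 0"
          using sin_angle_nonneg[OF y(1)] by (simp add: mult_le_0_iff)
        then show False using le y(2) by linarith
      qed
      then have "\<Lambda> * sin (\<alpha> y) \<le> \<Lambda> * 1"
        by (intro mult_left_mono) auto
      then show False using le y(3) by linarith
    qed
    moreover have "x = (norm x / norm y) *\<^sub>R y"
    proof -
      have "x = norm x *\<^sub>R sgn x" using sx(1) by (simp add: sgn_div_norm)
      also have "sgn x = (1 / norm y) *\<^sub>R (norm y *\<^sub>R sgn x)" using y(2) by simp
      also have "norm y *\<^sub>R sgn x = y" using y(4) by (rule sym)
      finally show ?thesis by simp
    qed
    ultimately show "x \<in> (\<Union>t\<in>{0..}. (*\<^sub>R) t ` N)"
      by (intro UN_I[of "norm x / norm y"] image_eqI) auto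
  qed
  ultimately show False
    using open_not_negligible N(2) negligible_subset by (metis empty_iff)
qed

text \<open>If the local dilatation at \<open>u\<close> is less than \<open>K\<close>, then \<open>(\<rho>(z) - \<rho>(u))\<^sup>2 \<le> (K\<^sup>2 - \<rho>(z) \<rho>(u)) \<bar>z - u\<bar>\<^sup>2\<close>
  near \<open>u\<close>, while the slope of \<open>t \<mapsto> arcsin (t / L)\<close> at \<open>t\<close> is \<open>1 / sqrt (L\<^sup>2 - t\<^sup>2)\<close>. The gap between \<open>K\<close> and
  \<open>L\<close> absorbs the variation of \<open>\<rho>\<close> near \<open>u\<close>.\<close>

lemma local_arcsin_bound:
  assumes u: "u \<in> S" and \<Lambda>: "0 < K" "K < L" "\<And>z. z \<in> S \<Longrightarrow> \<rho> z < L"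
    and lt: "\<rho> u < K * sin (\<alpha> (\<phi> u))"
  shows "\<forall>\<^sub>F z in at u within S. \<bar>arcsin (\<rho> z / L) - arcsin (\<rho> u / L)\<bar> \<le> norm (z - u)"
proof -
  have "((\<lambda>z. (max (\<rho> z) (\<rho> u))\<^sup>2 - \<rho> z * \<rho> u) \<longlongrightarrow> (max (\<rho> u) (\<rho> u))\<^sup>2 - \<rho> u * \<rho> u) (at u within S)"
    by (intro tendsto_diff tendsto_power tendsto_max tendsto_mult tendsto_const rho_tendsto[OF u])
  then have 1: "\<forall>\<^sub>F z in at u within S. (max (\<rho> z) (\<rho> u))\<^sup>2 - \<rho> z * \<rho> u < L\<^sup>2 - K\<^sup>2"
    by (rule order_tendstoD) (use \<Lambda> in \<open>auto simp: power2_eq_square intro!: mult_strict_mono\<close>)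
  have 2: "\<forall>\<^sub>F z in at u within S. z \<in> S"
    by (simp add: eventually_at_filter)
  show ?thesis
    using eventually_dist_phi_le[OF u \<Lambda>(1) lt] 1 2
  proof eventually_elim
    case (elim z)
    define m where "m = max (\<rho> z) (\<rho> u)"
    have m: "m < L" "0 \<le> m" "\<rho> z \<le> m" "\<rho> u \<le> m" using \<Lambda>(3)[OF u] \<Lambda>(3)[OF elim(3)] by (simp_all add: m_def max.coboundedI1)
    have mL: "m\<^sup>2 < L\<^sup>2" using m by (intro power_strict_mono) auto
    have "(norm (\<phi> z - \<phi> u))\<^sup>2 \<le> (K * norm (z - u))\<^sup>2"
      using elim(1) by (intro power_mono) auto
    then have "(\<rho> z - \<rho> u)\<^sup>2 \<le> (K\<^sup>2 - \<rho> z * \<rho> u) * (norm (z - u))\<^sup>2"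
      unfolding dist_phi_sq[OF elim(3) u] by (simp add: power_mult_distrib algebra_simps)
    also have "\<dots> \<le> (L\<^sup>2 - m\<^sup>2) * (norm (z - u))\<^sup>2"
      using elim(2) by (intro mult_right_mono) (auto simp: m_def)
    also have "\<dots> = (sqrt (L\<^sup>2 - m\<^sup>2) * norm (z - u))\<^sup>2"
      using mL by (simp add: power_mult_distrib)
    finally have "\<bar>\<rho> z - \<rho> u\<bar> \<le> sqrt (L\<^sup>2 - m\<^sup>2) * norm (z - u)"
      unfolding abs_le_square_iff[symmetric] using mL by (simp add: abs_mult)
    then have "\<bar>\<rho> z - \<rho> u\<bar> / sqrt (L\<^sup>2 - m\<^sup>2) \<le> norm (z - u)"
      using mL by (simp add: pos_divide_le_eq mult.commute)
    moreover have "\<bar>arcsin (\<rho> z / L) - arcsin (\<rho> u / L)\<bar> \<le> \<bar>\<rho> z - \<rho> u\<bar> / sqrt (L\<^sup>2 - m\<^sup>2)"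
      using m by (intro abs_arcsin_diff_le) auto
    ultimately show ?case by linarith
  qed
qed

text \<open>The bound available at exceptional points, where the local dilatation may exceed \<open>L\<close>.\<close>

lemma local_arcsin_bound_crude:
  assumes u: "u \<in> S" and \<Lambda>: "0 < K" "\<And>z. z \<in> S \<Longrightarrow> \<rho> z \<le> m" "m < L"
    and lt: "\<rho> u < K * sin (\<alpha> (\<phi> u))"
  shows "\<forall>\<^sub>F z in at u within S. \<bar>arcsin (\<rho> z / L) - arcsin (\<rho> u / L)\<bar> \<le> K / sqrt (L\<^sup>2 - m\<^sup>2) * norm (z - u)"
proof -
  have "0 \<le> m" using \<Lambda>(2)[OF u] by (rule order_trans[OF norm_ge_zero])
  then have mL: "m\<^sup>2 < L\<^sup>2" using \<Lambda>(3) by (intro power_strict_mono) auto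
  have "\<forall>\<^sub>F z in at u within S. z \<in> S"
    by (simp add: eventually_at_filter)
  with eventually_dist_phi_le[OF u \<Lambda>(1) lt] show ?thesis
  proof eventually_elim
    case (elim z)
    have "\<bar>\<rho> z - \<rho> u\<bar> \<le> norm (\<phi> z - \<phi> u)" by (rule norm_triangle_ineq3)
    also note elim(1)
    finally have "\<bar>\<rho> z - \<rho> u\<bar> / sqrt (L\<^sup>2 - m\<^sup>2) \<le> K * norm (z - u) / sqrt (L\<^sup>2 - m\<^sup>2)"
      using mL by (intro divide_right_mono) auto
    moreover have "\<bar>arcsin (\<rho> z / L) - arcsin (\<rho> u / L)\<bar> \<le> \<bar>\<rho> z - \<rho> u\<bar> / sqrt (L\<^sup>2 - m\<^sup>2)"
      using \<Lambda>(2)[OF u] \<Lambda>(2)[OF elim(2)] \<Lambda>(3) by (intro abs_arcsin_diff_le) auto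
    ultimately show ?case by simp
  qed
qed

text \<open>The local-to-global step on an arc of a great circle that meets the preimage of the exceptional set
  in a null set.\<close>

lemma dist_phi_arc_le:
  assumes e: "norm e1 = 1" "norm e2 = 1" "e1 \<bullet> e2 = 0"
    and le: "s \<le> t" "t - s \<le> pi"
    and tc: "\<And>x. x \<in> M \<Longrightarrow> 0 < a \<and> a \<le> sin (\<alpha> x)"
    and rho: "\<And>z. z \<in> S \<Longrightarrow> \<rho> z \<le> \<Lambda>" and \<Lambda>: "\<Lambda> < L"
    and good: "\<And>x. x \<in> M - N \<Longrightarrow> norm x \<le> \<Lambda> * sin (\<alpha> x)"
    and null: "negligible {\<theta> \<in> {s..t}. \<phi> (cos \<theta> *\<^sub>R e1 + sin \<theta> *\<^sub>R e2) \<in> N}"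
  defines "c \<equiv> \<lambda>\<theta>. cos \<theta> *\<^sub>R e1 + sin \<theta> *\<^sub>R e2"
  shows "norm (\<phi> (c t) - \<phi> (c s)) \<le> L * norm (c t - c s)"
proof -
  have cS: "c \<theta> \<in> S" for \<theta> unfolding c_def using e by (rule arc_in_S)
  have c_lip: "norm (c x - c y) \<le> \<bar>x - y\<bar>" for x y unfolding c_def using e by (rule norm_arc_diff_le)
  have c_sq: "(norm (c x - c y))\<^sup>2 = 2 * (1 - cos (x - y))" for x y
    unfolding c_def using e by (rule norm_arc_diff_sq)
  have \<Lambda>pos: "0 < \<Lambda>" using rho_pos[OF cS[of 0]] rho[OF cS[of 0]] by linarith
  define f where "f \<theta> = arcsin (\<rho> (c \<theta>) / L)" for \<theta>
  have transfer: "\<forall>\<^sub>F y in at x. \<bar>f y - f x\<bar> \<le> C * \<bar>y - x\<bar>"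
    if C: "0 \<le> C" and ev: "\<forall>\<^sub>F z in at (c x) within S. \<bar>arcsin (\<rho> z / L) - arcsin (\<rho> (c x) / L)\<bar> \<le> C * norm (z - c x)" for C x
  proof -
    obtain d where d: "d > 0" "\<And>z. z \<in> S \<Longrightarrow> z \<noteq> c x \<Longrightarrow> dist z (c x) < d \<Longrightarrow>
        \<bar>arcsin (\<rho> z / L) - arcsin (\<rho> (c x) / L)\<bar> \<le> C * norm (z - c x)"
      using ev unfolding eventually_at by auto
    have "\<bar>f y - f x\<bar> \<le> C * \<bar>y - x\<bar>" if "dist y x < d" for y
    proof (cases "c y = c x")
      case True then show ?thesis using C by (simp add: f_def)
    next
      case False
      have "dist (c y) (c x) < d"
        using c_lip[of y x] that by (simp add: dist_norm)
      then have "\<bar>f y - f x\<bar> \<le> C * norm (c y - c x)"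
        unfolding f_def using d(2)[OF cS False] by simp
      also have "\<dots> \<le> C * \<bar>y - x\<bar>"
        using c_lip C by (intro mult_left_mono)
      finally show ?thesis .
    qed
    then show ?thesis unfolding eventually_at using d(1) by blast
  qed
  have x_pos: "0 < sin (\<alpha> (\<phi> (c x)))" for x
    using tc[OF phi_in_M[OF cS]] by (auto intro: less_le_trans)
  define K where "K = \<Lambda> / a + 1"
  have a: "0 < a" using tc[OF phi_in_M[OF cS[of 0]]] by simp
  have K: "0 < K" unfolding K_def using a \<Lambda>pos by (simp add: add_pos_pos)
  have "\<Lambda>\<^sup>2 < L\<^sup>2" using \<Lambda> \<Lambda>pos by (intro power_strict_mono) auto
  have "\<bar>f t - f s\<bar> \<le> t - s"
  proof (rule abs_increment_le_of_local_bounds[OF le(1) null])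
    fix x assume x: "x \<in> {s..t} - {\<theta> \<in> {s..t}. \<phi> (cos \<theta> *\<^sub>R e1 + sin \<theta> *\<^sub>R e2) \<in> N}"
    then have "\<phi> (c x) \<notin> N" by (simp add: c_def)
    then have "\<rho> (c x) \<le> \<Lambda> * sin (\<alpha> (\<phi> (c x)))"
      using good phi_in_M[OF cS] by simp
    also have "\<dots> < (\<Lambda> + L) / 2 * sin (\<alpha> (\<phi> (c x)))"
      using x_pos \<Lambda> by (intro mult_strict_right_mono) auto
    finally have "\<forall>\<^sub>F z in at (c x) within S. \<bar>arcsin (\<rho> z / L) - arcsin (\<rho> (c x) / L)\<bar> \<le> norm (z - c x)"
      by (rule local_arcsin_bound[OF cS, rotated 3]) (use \<Lambda>pos \<Lambda> rho in \<open>auto intro: le_less_trans\<close>)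
    then show "\<forall>\<^sub>F y in at x. \<bar>f y - f x\<bar> \<le> \<bar>y - x\<bar>"
      using transfer[of 1 x] by simp
  next
    fix x
    have "\<rho> (c x) \<le> \<Lambda>" by (rule rho[OF cS])
    also have "\<Lambda> < K * a" using a by (simp add: K_def field_simps)
    also have "K * a \<le> K * sin (\<alpha> (\<phi> (c x)))"
      using K tc[OF phi_in_M[OF cS]] by (intro mult_left_mono) auto
    finally have "\<forall>\<^sub>F z in at (c x) within S. \<bar>arcsin (\<rho> z / L) - arcsin (\<rho> (c x) / L)\<bar>
        \<le> K / sqrt (L\<^sup>2 - \<Lambda>\<^sup>2) * norm (z - c x)"
      by (intro local_arcsin_bound_crude[OF cS K _ \<Lambda>] rho)
    then show "\<forall>\<^sub>F y in at x. \<bar>f y - f x\<bar> \<le> K / sqrt (L\<^sup>2 - \<Lambda>\<^sup>2) * \<bar>y - x\<bar>"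
      using transfer[of "K / sqrt (L\<^sup>2 - \<Lambda>\<^sup>2)" x] K \<open>\<Lambda>\<^sup>2 < L\<^sup>2\<close> by simp
  qed
  from sin_diff_le_of_angle_le[OF this le(2)]
  have *: "(sin (f t) - sin (f s))\<^sup>2 + 2 * (sin (f t) * sin (f s)) * (1 - cos (t - s)) \<le> 2 * (1 - cos (t - s))" .
  have sin_f: "sin (f x) = \<rho> (c x) / L" for x
    unfolding f_def using rho[OF cS[of x]] \<Lambda> \<Lambda>pos
    by (intro sin_arcsin) (auto simp: divide_le_eq intro: order_trans[of "-1" 0])
  have "(norm (\<phi> (c t) - \<phi> (c s)))\<^sup>2 = (\<rho> (c t) - \<rho> (c s))\<^sup>2 + \<rho> (c t) * \<rho> (c s) * (2 * (1 - cos (t - s)))"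
    unfolding dist_phi_sq[OF cS cS] c_sq ..
  also have "\<dots> = L\<^sup>2 * ((sin (f t) - sin (f s))\<^sup>2 + 2 * (sin (f t) * sin (f s)) * (1 - cos (t - s)))"
  proof -
    have "\<rho> (c x) = L * sin (f x)" for x using sin_f[of x] \<Lambda> \<Lambda>pos by simp
    then show ?thesis by (simp only: power2_eq_square) (simp add: algebra_simps)
  qed
  also have "\<dots> \<le> L\<^sup>2 * (2 * (1 - cos (t - s)))"
    by (intro mult_left_mono *) auto
  also have "\<dots> = (L * norm (c t - c s))\<^sup>2"
    by (simp add: power_mult_distrib c_sq)
  finally show ?thesis
    by (rule power2_le_imp_le) (use \<Lambda> \<Lambda>pos in auto)
qed


text \<open>The segment from \<open>p\<close> to \<open>q\<close> lies on a line at distance \<open>h > 0\<close> from \<open>0\<close>. With \<open>e1\<close> pointing to the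
  foot of the perpendicular and \<open>e2\<close> along the line, the point \<open>h e1 + y e2\<close> projects radially to the
  point of angle \<open>arctan (y / h)\<close>; as this reparametrisation is differentiable, it preserves null sets.\<close>

lemma dist_phi_segment_le:
  assumes pq: "\<bar>p \<bullet> q\<bar> < norm p * norm q"
    and null: "negligible {s. p + s *\<^sub>R (q - p) \<in> (\<Union>t\<in>{0..}. (*\<^sub>R) t ` N)}"
    and tc: "\<And>x. x \<in> M \<Longrightarrow> 0 < a \<and> a \<le> sin (\<alpha> x)"
    and rho: "\<And>z. z \<in> S \<Longrightarrow> \<rho> z \<le> \<Lambda>" and \<Lambda>: "\<Lambda> < L"
    and good: "\<And>x. x \<in> M - N \<Longrightarrow> norm x \<le> \<Lambda> * sin (\<alpha> x)"
  shows "norm (\<phi> (sgn q) - \<phi> (sgn p)) \<le> L * norm (sgn q - sgn p)"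
proof -
  define w where "w = norm (q - p)"
  define e2 where "e2 = sgn (q - p)"
  define k where "k = p \<bullet> e2"
  define h where "h = norm (p - k *\<^sub>R e2)"
  define e1 where "e1 = sgn (p - k *\<^sub>R e2)"
  define c where "c \<theta> = cos \<theta> *\<^sub>R e1 + sin \<theta> *\<^sub>R e2" for \<theta>
  have "q \<noteq> p"
    using pq by (auto simp: power2_norm_eq_inner[symmetric] power2_eq_square)
  then have w: "0 < w" "q - p = w *\<^sub>R e2" and e2: "norm e2 = 1"
    by (simp_all add: w_def e2_def sgn_div_norm)
  have "p \<noteq> k *\<^sub>R e2"
  proof
    assume p: "p = k *\<^sub>R e2"
    then have q: "q = (k + w) *\<^sub>R e2" using w(2) by (simp add: algebra_simps)
    have "e2 \<bullet> e2 = 1" using e2 by (simp add: norm_eq_1)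
    then have "\<bar>p \<bullet> q\<bar> = norm p * norm q"
      by (subst (1 2) p, subst (1 2) q) (simp add: e2 abs_mult)
    then show False using pq by simp
  qed
  then have h: "0 < h" "p - k *\<^sub>R e2 = h *\<^sub>R e1" and e1: "norm e1 = 1"
    by (simp_all add: h_def e1_def sgn_div_norm)
  have "e2 \<bullet> e2 = 1" using e2 by (simp add: norm_eq_1)
  have "h * (e1 \<bullet> e2) = (p - k *\<^sub>R e2) \<bullet> e2" by (simp add: h(2))
  also have "\<dots> = 0" using \<open>e2 \<bullet> e2 = 1\<close> by (simp add: inner_diff_left k_def)
  finally have orth: "e1 \<bullet> e2 = 0" using h(1) by simp
  have line: "p + s *\<^sub>R (q - p) = h *\<^sub>R e1 + (k + s * w) *\<^sub>R e2" for s
  proof -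
    have "p + s *\<^sub>R (q - p) = (p - k *\<^sub>R e2) + (k + s * w) *\<^sub>R e2"
      unfolding w(2) by (simp add: scaleR_add_left)
    then show ?thesis unfolding h(2) .
  qed
  have arc: "h *\<^sub>R e1 + y *\<^sub>R e2 = (h / cos (arctan (y / h))) *\<^sub>R c (arctan (y / h))" for y
  proof -
    have "cos (arctan (y / h)) \<noteq> 0" by (rule cos_arctan_not_zero)
    moreover have "h * (sin (arctan (y / h)) / cos (arctan (y / h))) = y"
      using h(1) tan_arctan[of "y / h"] by (simp add: tan_def)
    ultimately show ?thesis by (simp add: c_def scaleR_add_right)
  qed
  have cos_pos: "0 < cos (arctan y)" for y by (simp add: cos_arctan add_pos_nonneg)
  have cS: "c \<theta> \<in> S" for \<theta> unfolding c_def using e1 e2 orth by (rule arc_in_S)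
  have sgn_line: "sgn (h *\<^sub>R e1 + y *\<^sub>R e2) = c (arctan (y / h))" for y
  proof -
    have "0 < h / cos (arctan (y / h))" using h(1) cos_pos by simp
    moreover have "sgn (c \<theta>) = c \<theta>" for \<theta> using cS[of \<theta>] by (simp add: sgn_div_norm)
    ultimately show ?thesis unfolding arc sgn_scaleR by (simp only: sgn_pos scaleR_one)
  qed
  define s t where "s = arctan (k / h)" and "t = arctan ((k + w) / h)"
  have sgn_p: "sgn p = c s" and sgn_q: "sgn q = c t"
    using sgn_line[of k] sgn_line[of "k + w"] line[of 0] line[of 1] by (simp_all add: s_def t_def)
  have st: "s \<le> t" "t - s \<le> pi"
    unfolding s_def t_def using w(1) h(1) arctan_bounded[of "k / h"] arctan_bounded[of "(k + w) / h"]
    by (auto simp: arctan_le_iff divide_right_mono)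
  have "negligible ((\<lambda>x. arctan ((k + x * w) / h)) ` {s. p + s *\<^sub>R (q - p) \<in> (\<Union>t\<in>{0..}. (*\<^sub>R) t ` N)})"
  proof (rule negligible_differentiable_image_negligible[OF order_refl null])
    have "(\<lambda>x. arctan ((k + x * w) / h)) differentiable (at x)" for x
    proof -
      have "((\<lambda>x. arctan ((k + x * w) / h)) has_field_derivative
          inverse (1 + ((k + x * w) / h)\<^sup>2) * (w / h)) (at x)"
        using h(1) by (auto intro!: derivative_eq_intros simp: field_simps)
      then show ?thesis by (meson real_differentiable_def)
    qed
    then show "(\<lambda>x. arctan ((k + x * w) / h)) differentiable_on {s. p + s *\<^sub>R (q - p) \<in> (\<Union>t\<in>{0..}. (*\<^sub>R) t ` N)}"
      unfolding differentiable_on_def by (meson differentiable_at_withinI)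
  qed
  then have "negligible {\<theta> \<in> {s..t}. \<phi> (cos \<theta> *\<^sub>R e1 + sin \<theta> *\<^sub>R e2) \<in> N}"
  proof (rule negligible_subset, intro subsetI)
    fix \<theta> assume "\<theta> \<in> {\<theta> \<in> {s..t}. \<phi> (cos \<theta> *\<^sub>R e1 + sin \<theta> *\<^sub>R e2) \<in> N}"
    then have \<theta>: "s \<le> \<theta>" "\<theta> \<le> t" "\<phi> (c \<theta>) \<in> N" by (auto simp: c_def)
    have "- (pi / 2) < \<theta>" "\<theta> < pi / 2"
      using \<theta>(1,2) arctan_bounded[of "k / h"] arctan_bounded[of "(k + w) / h"] by (auto simp: s_def t_def)
    then have at: "arctan (tan \<theta>) = \<theta>" "0 < cos \<theta>" by (auto intro: arctan_tan cos_gt_zero_pi)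
    define x where "x = (h * tan \<theta> - k) / w"
    have "k + x * w = h * tan \<theta>" using w(1) by (simp add: x_def)
    then have th: "arctan ((k + x * w) / h) = \<theta>" using h(1) at(1) by simp
    have "p + x *\<^sub>R (q - p) = (h / cos \<theta>) *\<^sub>R c \<theta>"
      unfolding line arc[of "k + x * w"] th ..
    also have "\<dots> = (h / cos \<theta> / \<rho> (c \<theta>)) *\<^sub>R (\<rho> (c \<theta>) *\<^sub>R c \<theta>)"
      using less_imp_neq[OF rho_pos[OF cS[of \<theta>]], symmetric] by simp
    also have "\<rho> (c \<theta>) *\<^sub>R c \<theta> = \<phi> (c \<theta>)"
      by (rule phi_eq[OF cS, symmetric])
    finally have "p + x *\<^sub>R (q - p) \<in> (\<Union>t\<in>{0..}. (*\<^sub>R) t ` N)"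
      using \<theta>(3) h(1) at(2) by (intro UN_I[of "h / cos \<theta> / \<rho> (c \<theta>)"] image_eqI) auto
    then show "\<theta> \<in> (\<lambda>x. arctan ((k + x * w) / h)) ` {s. p + s *\<^sub>R (q - p) \<in> (\<Union>t\<in>{0..}. (*\<^sub>R) t ` N)}"
      using th by (intro image_eqI[of _ _ x]) auto
  qed
  from dist_phi_arc_le[OF e1 e2 orth st tc rho \<Lambda> good this]
  show ?thesis unfolding sgn_p sgn_q c_def .
qed

text \<open>The exceptional set \<open>N\<close> does not affect the Lipschitz constant.\<close>

lemma lipschitz_on_phi_of_ae_bound:
  assumes tc: "\<And>x. x \<in> M \<Longrightarrow> 0 < a \<and> a \<le> sin (\<alpha> x)"
    and N: "N \<subseteq> M" "hausdorff_outer (DIM('a) - 1) N = 0"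
    and good: "\<And>x. x \<in> M - N \<Longrightarrow> norm x \<le> \<Lambda> * sin (\<alpha> x)"
  shows "\<Lambda>-lipschitz_on S \<phi>"
proof -
  let ?C = "\<Union>t\<in>{0..}. (*\<^sub>R) t ` N"
  have "bounded N" using N(1) compact_M compact_imp_bounded bounded_subset by metis
  then have C: "negligible ?C"
    using dim N(2) by (intro negligible_cone_of_hausdorff_null)
  have rho: "\<rho> z \<le> \<Lambda>" if "z \<in> S" for z
    using rho_le_of_ae_bound[OF N(1) C good that] .
  obtain u0 where "u0 \<in> S" using ex_unit by auto
  then have \<Lambda>pos: "0 < \<Lambda>" using rho[of u0] rho_pos[of u0] by linarith
  show ?thesis
  proof (rule lipschitz_on_of_greater)
    fix L assume L: "\<Lambda> < L"
    show "L-lipschitz_on S \<phi>"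
    proof (rule lipschitz_onI)
      fix u v assume uv: "u \<in> S" "v \<in> S"
      have nuv: "norm u = 1" "norm v = 1" using uv by simp_all
      have sgn_uv: "sgn u = u" "sgn v = v" using nuv by (simp_all add: sgn_div_norm)
      consider "u = v" | "v = - u" | "\<bar>u \<bullet> v\<bar> < 1"
      proof -
        have "\<bar>u \<bullet> v\<bar> \<le> 1" using Cauchy_Schwarz_ineq2[of u v] nuv by simp
        moreover have "u = v" if "u \<bullet> v = 1"
          using that nuv norm_cauchy_schwarz_eq[of u v] by simp
        moreover have "v = - u" if "u \<bullet> v = - 1"
        proof -
          have "u \<bullet> (- v) = 1" using that by simp
          then have "u = - v" using nuv norm_cauchy_schwarz_eq[of u "- v"] by simp
          then show ?thesis by simp
        qed
        ultimately show thesis using that by (cases "\<bar>u \<bullet> v\<bar> = 1") (auto simp: abs_if split: if_splits)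
      qed
      then show "dist (\<phi> u) (\<phi> v) \<le> L * dist u v"
      proof cases
        case 1 then show ?thesis by simp
      next
        case 2
        have "norm (\<phi> u - \<phi> v) \<le> \<rho> u + \<rho> v" by (rule norm_triangle_ineq4)
        also have "\<dots> \<le> L * 2" using rho[OF uv(1)] rho[OF uv(2)] L by simp
        also have "2 = norm (u - v)" using 2 nuv by (simp flip: scaleR_2)
        finally show ?thesis by (simp add: dist_norm)
      next
        case 3
        \<comment> \<open>Translate the segment from \<open>u\<close> to \<open>v\<close> slightly, so that its line meets the cone in a null set.\<close>
        have "\<exists>p. p \<in> ball u (1 / Suc n) \<and> negligible {s. p + s *\<^sub>R (v - u) \<in> ?C}" for n
          by (rule exists_negligible_line_section[OF C, of "ball u (1 / Suc n)" "v - u"]) auto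
        then obtain p where p: "\<And>n. p n \<in> ball u (1 / Suc n)"
            "\<And>n. negligible {s. p n + s *\<^sub>R (v - u) \<in> ?C}" by metis
        define q where "q n = p n + (v - u)" for n
        have p_lim: "p \<longlonglongrightarrow> u"
        proof (rule LIMSEQ_I)
          fix r :: real assume "0 < r"
          then obtain n0 where n0: "1 / real (Suc n0) < r" using nat_approx_posE by blast
          show "\<exists>n0. \<forall>n\<ge>n0. norm (p n - u) < r"
          proof (intro exI allI impI)
            fix n assume "n0 \<le> n"
            then have "1 / real (Suc n) \<le> 1 / real (Suc n0)" by (simp add: frac_le)
            moreover have "norm (p n - u) < 1 / real (Suc n)"
              using p(1)[of n] by (simp add: dist_norm norm_minus_commute)
            ultimately show "norm (p n - u) < r" using n0 by linarith
          qed
        qed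
        then have "q \<longlonglongrightarrow> u + (v - u)" unfolding q_def by (intro tendsto_intros)
        then have q_lim: "q \<longlonglongrightarrow> v" by simp
        have lim: "(\<lambda>n. \<phi> (sgn (x n))) \<longlonglongrightarrow> \<phi> (sgn y)" "(\<lambda>n. sgn (x n)) \<longlonglongrightarrow> sgn y"
          if "x \<longlonglongrightarrow> y" "norm y = 1" for x :: "nat \<Rightarrow> 'a" and y
        proof -
          have y: "y \<in> - {0}" using that(2) by auto
          have "isCont (\<lambda>x. \<phi> (sgn x)) y"
            using continuous_on_phi_sgn y by (simp add: continuous_on_eq_continuous_at open_Compl)
          then show "(\<lambda>n. \<phi> (sgn (x n))) \<longlonglongrightarrow> \<phi> (sgn y)"
            using that(1) by (rule isCont_tendsto_compose)
          show "(\<lambda>n. sgn (x n)) \<longlonglongrightarrow> sgn y"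
            using that(1) y by (intro tendsto_sgn) auto
        qed
        have "(\<lambda>n. norm (p n) * norm (q n) - \<bar>p n \<bullet> q n\<bar>) \<longlonglongrightarrow> norm u * norm v - \<bar>u \<bullet> v\<bar>"
          by (intro tendsto_intros p_lim q_lim)
        then have "\<forall>\<^sub>F n in sequentially. 0 < norm (p n) * norm (q n) - \<bar>p n \<bullet> q n\<bar>"
          by (rule order_tendstoD) (use 3 nuv in simp)
        then have ev: "\<forall>\<^sub>F n in sequentially. norm (\<phi> (sgn (q n)) - \<phi> (sgn (p n))) \<le> L * norm (sgn (q n) - sgn (p n))"
        proof eventually_elim
          case (elim n)
          have "\<bar>p n \<bullet> q n\<bar> < norm (p n) * norm (q n)" using elim by simp
          moreover have "negligible {s. p n + s *\<^sub>R (q n - p n) \<in> ?C}"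
            using p(2)[of n] by (simp add: q_def)
          ultimately show ?case
            by (rule dist_phi_segment_le[OF _ _ tc rho L good])
        qed
        have "norm (\<phi> (sgn v) - \<phi> (sgn u)) \<le> L * norm (sgn v - sgn u)"
          by (rule tendsto_le[OF _ _ _ ev]) (intro trivial_limit_sequentially tendsto_intros lim p_lim q_lim nuv)+
        then show ?thesis unfolding sgn_uv by (simp add: dist_norm norm_minus_commute)
      qed
    qed (use L \<Lambda>pos in simp)
  qed
qed

section \<open>The inverse of the radial homeomorphism\<close>

lemma infdist_eq_INF: "infdist 0 M = (INF x\<in>M. norm x)"
  using M_nonempty by (simp add: infdist_def)

lemma infdist_pos: "0 < infdist 0 M"
  using zero_notin_M M_nonempty compact_M infdist_pos_not_in_closed[of M 0] compact_imp_closed by blast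

lemma infdist_le_norm: "x \<in> M \<Longrightarrow> infdist 0 M \<le> norm x"
  using infdist_le[of x M 0] by simp

lemma norm_le_SUP: "x \<in> M \<Longrightarrow> norm x \<le> (SUP x\<in>M. norm x)"
proof (rule cSUP_upper)
  show "bdd_above (norm ` M)"
    using compact_imp_bounded[OF compact_M] unfolding bounded_iff bdd_above_def by auto
qed

lemma mult_norm_diff_le: "z \<in> S \<Longrightarrow> u \<in> S \<Longrightarrow> infdist 0 M * norm (z - u) \<le> norm (\<phi> z - \<phi> u)"
proof (rule power2_le_imp_le)
  assume zu: "z \<in> S" "u \<in> S"
  have "(infdist 0 M * norm (z - u))\<^sup>2 = infdist 0 M * infdist 0 M * (norm (z - u))\<^sup>2"
    by (simp add: power2_eq_square)
  also have "\<dots> \<le> \<rho> z * \<rho> u * (norm (z - u))\<^sup>2"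
    using infdist_le_norm[OF phi_in_M] zu infdist_pos by (intro mult_right_mono mult_mono) auto
  also have "\<dots> \<le> (norm (\<phi> z - \<phi> u))\<^sup>2"
    unfolding dist_phi_sq[OF zu] by simp
  finally show "(infdist 0 M * norm (z - u))\<^sup>2 \<le> (norm (\<phi> z - \<phi> u))\<^sup>2" .
qed simp

lemma ratio_inverse_le:
  "z \<in> S \<Longrightarrow> u \<in> S \<Longrightarrow> norm (z - u) / norm (\<phi> z - \<phi> u) \<le> 1 / infdist 0 M"
proof (cases "z = u")
  case False
  assume zu: "z \<in> S" "u \<in> S"
  then have "0 < norm (\<phi> z - \<phi> u)" using False phi_eq_iff by simp
  then show ?thesis using mult_norm_diff_le[OF zu] infdist_pos by (simp add: field_simps)
qed (use infdist_pos in simp)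

text \<open>The pair lies on a great circle through a minimum point of \<open>\<rho>\<close>, the two points on opposite sides of it,
  unless one of them is the minimum point itself.\<close>

lemma exists_close_pair_with_equal_radius:
  assumes r: "0 < r" and b: "infdist 0 M < b"
  obtains z u where "z \<in> S" "u \<in> S" "z \<noteq> u" "norm (z - u) < r" "\<rho> z = \<rho> u" "\<rho> u < b"
proof -
  obtain x0 where x0: "x0 \<in> M" "infdist 0 M = norm x0"
    using infdist_attains_inf[OF compact_imp_closed[OF compact_M] M_nonempty, of 0] by auto
  define e1 where "e1 = sgn x0"
  have e1: "e1 \<in> S" "\<phi> e1 = x0" using x0 phi_sgn sgn_boundary_in_S by (simp_all add: e1_def del: mem_sphere_0)
  then have ne1: "norm e1 = 1" by simp
  obtain e where e: "e \<noteq> 0" "orthogonal e1 e"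
    using ne1 dim orthogonal_to_vector_exists[of e1] by blast
  define e2 where "e2 = sgn e"
  have e2: "norm e2 = 1" "e1 \<bullet> e2 = 0"
    using e by (auto simp: e2_def norm_sgn sgn_div_norm orthogonal_def)
  define c where "c t = cos t *\<^sub>R e1 + sin t *\<^sub>R e2" for t
  have cS: "c t \<in> S" for t unfolding c_def using ne1 e2 by (rule arc_in_S)
  have c_lip: "norm (c s - c t) \<le> \<bar>s - t\<bar>" for s t unfolding c_def using ne1 e2 by (rule norm_arc_diff_le)
  define g where "g t = \<rho> (c t)" for t
  have c_cont: "continuous_on UNIV c" unfolding c_def by (intro continuous_intros)
  have "continuous_on UNIV (\<lambda>t. \<phi> (c t))"
    using cS by (intro continuous_on_compose2[OF continuous_phi c_cont]) blast
  then have g_cont: "continuous_on A g" for A unfolding g_def by (auto intro: continuous_on_subset continuous_on_norm)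
  have g0: "g 0 = infdist 0 M" using e1 x0 by (simp add: g_def c_def)
  have g_ge: "g 0 \<le> g t" for t unfolding g0 unfolding g_def by (rule infdist_le_norm[OF phi_in_M[OF cS]])
  have "isCont g 0" using g_cont[of UNIV] by (simp add: continuous_on_eq_continuous_at)
  then have "(g \<longlongrightarrow> g 0) (at 0)" by (simp add: isCont_def)
  then have "\<forall>\<^sub>F t in at 0. g t < b" using b g0 by (intro order_tendstoD) auto
  then obtain d0 where d0: "d0 > 0" "\<And>t. t \<noteq> 0 \<Longrightarrow> \<bar>t\<bar> < d0 \<Longrightarrow> g t < b"
    unfolding eventually_at by (auto simp: dist_real_def)
  define d where "d = min (min (d0 / 2) (r / 3)) 1"
  have d: "0 < d" "d < d0" "2 * d < r" "d \<le> 1" using d0(1) r by (auto simp: d_def)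
  have gb: "g t < b" if "\<bar>t\<bar> \<le> d" for t using d0(2)[of t] d that g0 b by (cases "t = 0") auto
  have "\<exists>s t. - d \<le> s \<and> s < t \<and> t \<le> d \<and> g s = g t"
  proof -
    define v where "v = min (g (- d)) (g d)"
    have v: "g 0 \<le> v" "v \<le> g (- d)" "v \<le> g d" using g_ge by (auto simp: v_def)
    obtain t where t: "0 \<le> t" "t \<le> d" "g t = v"
      using IVT'[of g 0 v d] v d g_cont by auto
    obtain s where s: "- d \<le> s" "s \<le> 0" "g s = v"
      using IVT2'[of g 0 v "- d"] v d g_cont by auto
    show ?thesis
    proof (cases "s < t")
      case True then show ?thesis using s t by (intro exI[of _ s] exI[of _ t]) auto
    next
      case False
      \<comment> \<open>The value at one of the end points already equals the minimum.\<close>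
      then have "s = 0" "t = 0" using s t by auto
      then have "v = g 0" using t by simp
      then consider "g (- d) = g 0" | "g d = g 0" unfolding v_def by linarith
      then show ?thesis
      proof cases
        case 1 then show ?thesis using d by (intro exI[of _ "- d"] exI[of _ 0]) auto
      next
        case 2 then show ?thesis using d by (intro exI[of _ 0] exI[of _ d]) auto
      qed
    qed
  qed
  then obtain s t where st: "- d \<le> s" "s < t" "t \<le> d" "g s = g t" by auto
  have "c s \<noteq> c t"
  proof
    assume "c s = c t"
    then have "2 * (1 - cos (s - t)) = 0"
      using norm_arc_diff_sq[OF ne1 e2, of s t] by (simp add: c_def)
    then have "cos (t - s) = 1" using cos_minus[of "t - s"] by simp
    moreover have "cos (t - s) < cos 0"
      using st d pi_gt3 by (intro cos_monotone_0_pi) auto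
    ultimately show False by simp
  qed
  moreover have "norm (c s - c t) < r"
    using c_lip[of s t] st d by linarith
  moreover have "\<rho> (c t) < b" using gb[of t] st by (simp add: g_def)
  ultimately show thesis using st(4) that[OF cS cS] by (simp add: g_def)
qed

text \<open>The supremum is the same at every scale \<open>r\<close>; for small \<open>r\<close> it gives the upper limit, and for any
  \<open>r\<close> the lower bound on the Lipschitz constant of the inverse.\<close>

lemma SUP_close_ratio:
  assumes r: "0 < r"
  shows "(SUP (z, \<zeta>) \<in> {(z, \<zeta>). z \<in> S \<and> \<zeta> \<in> S \<and> 0 < norm (z - \<zeta>) \<and> norm (z - \<zeta>) < r}.
            ereal (norm (z - \<zeta>) / norm (\<phi> z - \<phi> \<zeta>))) = ereal (1 / infdist 0 M)" (is "Sup (?f ` ?P) = _")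
proof (rule antisym)
  show "Sup (?f ` ?P) \<le> ereal (1 / infdist 0 M)"
    by (rule SUP_least) (use ratio_inverse_le in \<open>auto simp del: mem_sphere_0\<close>)
  show "ereal (1 / infdist 0 M) \<le> Sup (?f ` ?P)"
  proof (rule dense_le)
    fix y assume "y < ereal (1 / infdist 0 M)"
    then obtain y' where y': "y < ereal y'" "ereal y' < ereal (1 / infdist 0 M)"
      using ereal_dense2 by blast
    show "y \<le> Sup (?f ` ?P)"
    proof -
      \<comment> \<open>chosen so that \<open>\<rho> u < b\<close> implies \<open>y' \<le> 1 / \<rho> u\<close>, whatever the sign of \<open>y'\<close>\<close>
      define b where "b = (if y' \<le> 0 then infdist 0 M + 1 else 1 / y')"
      have "infdist 0 M < b" using y'(2) infdist_pos by (simp add: b_def field_simps)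
      from exists_close_pair_with_equal_radius[OF r this] obtain z u
        where zu: "z \<in> S" "u \<in> S" "z \<noteq> u" "norm (z - u) < r" "\<rho> z = \<rho> u" "\<rho> u < b" by metis
      have "(norm (\<phi> z - \<phi> u))\<^sup>2 = (\<rho> u * norm (z - u))\<^sup>2"
        unfolding dist_phi_sq[OF zu(1,2)] zu(5) by (simp add: power2_eq_square)
      then have eq: "norm (\<phi> z - \<phi> u) = \<rho> u * norm (z - u)"
        by (rule power2_eq_imp_eq) auto
      have "y' \<le> 1 / \<rho> u"
      proof (cases "y' \<le> 0")
        case True
        then show ?thesis by (meson order_trans norm_ge_zero zero_le_divide_1_iff)
      next
        case False
        then show ?thesis using zu(6) rho_pos[OF zu(2)] by (simp add: b_def field_simps)
      qed
      also have "1 / \<rho> u = norm (z - u) / norm (\<phi> z - \<phi> u)"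
        using zu(3) by (simp add: eq)
      finally have "ereal y' \<le> ?f (z, u)" by simp
      also have "\<dots> \<le> Sup (?f ` ?P)"
        using zu by (intro SUP_upper) (simp del: mem_sphere_0)
      finally show ?thesis using y'(1) by simp
    qed
  qed
qed

lemma Lip_inverse: "Lip M (inv_into S \<phi>) = ereal (1 / infdist 0 M)"
proof (rule antisym)
  have "(1 / infdist 0 M)-lipschitz_on M (inv_into S \<phi>)"
  proof (rule lipschitz_onI)
    fix x y assume xy: "x \<in> M" "y \<in> M"
    have "infdist 0 M * norm (sgn x - sgn y) \<le> norm (x - y)"
      using mult_norm_diff_le[of "sgn x" "sgn y"] xy phi_sgn sgn_boundary_in_S by (simp del: mem_sphere_0)
    then show "dist (inv_into S \<phi> x) (inv_into S \<phi> y) \<le> 1 / infdist 0 M * dist x y"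
      using xy infdist_pos by (simp add: inv_phi dist_norm field_simps)
  qed (use infdist_pos in simp)
  then show "Lip M (inv_into S \<phi>) \<le> ereal (1 / infdist 0 M)" by (rule Lip_le)
  have "ereal (1 / infdist 0 M) \<le> ereal K" if K: "K-lipschitz_on M (inv_into S \<phi>)" for K
    unfolding SUP_close_ratio[OF zero_less_one, symmetric]
  proof (rule SUP_least, clarify)
    fix z u assume zu: "z \<in> S" "u \<in> S" "0 < norm (z - u)"
    have "norm (z - u) \<le> K * norm (\<phi> z - \<phi> u)"
      using lipschitz_on_normD[OF K phi_in_M[OF zu(1)] phi_in_M[OF zu(2)]] zu
      by (simp add: inv_phi phi_in_M sgn_phi del: mem_sphere_0)
    moreover have "0 < norm (\<phi> z - \<phi> u)" using zu phi_eq_iff[of z u] by simp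
    ultimately show "ereal (norm (z - u) / norm (\<phi> z - \<phi> u)) \<le> ereal K"
      by (simp add: pos_divide_le_eq)
  qed
  then show "ereal (1 / infdist 0 M) \<le> Lip M (inv_into S \<phi>)"
    unfolding Lip_def by (intro Inf_greatest) auto
qed

lemma Limsup_ratio_inverse:
  "ereal (1 / infdist 0 M) = Limsup (at_right 0) (\<lambda>r. SUP (z, \<zeta>) \<in> {(z, \<zeta>). z \<in> S \<and> \<zeta> \<in> S \<and>
       0 < norm (z - \<zeta>) \<and> norm (z - \<zeta>) < r}. ereal (norm (z - \<zeta>) / norm (\<phi> z - \<phi> \<zeta>)))"
proof -
  have "Limsup (at_right 0) (\<lambda>r. SUP (z, \<zeta>) \<in> {(z, \<zeta>). z \<in> S \<and> \<zeta> \<in> S \<and>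
       0 < norm (z - \<zeta>) \<and> norm (z - \<zeta>) < r}. ereal (norm (z - \<zeta>) / norm (\<phi> z - \<phi> \<zeta>)))
     = Limsup (at_right (0::real)) (\<lambda>r. ereal (1 / infdist 0 M))"
    using eventually_at_right_less[of "0::real"]
    by (intro Limsup_eq) (rule eventually_mono, assumption, rule SUP_close_ratio)
  also have "\<dots> = ereal (1 / infdist 0 M)"
    by (rule Limsup_const) simp
  finally show ?thesis by (rule sym)
qed

section \<open>The tangent condition and the Lipschitz constant\<close>

lemma sin_bound_of_tangent_condition:
  assumes tc: "tangent_condition a M" and x: "x \<in> M"
  shows "0 < sin a \<and> sin a \<le> sin (\<alpha> x)"
  using tc x Liminf_segment_angle(3)[OF x] unfolding tangent_condition_def
  by (auto intro!: sin_gt_zero sin_monotone_2pi_le)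

lemma lipschitz_iff_sin_bound:
  assumes tc: "tangent_condition a M"
  shows "K-lipschitz_on S \<phi> \<longleftrightarrow> (\<forall>x\<in>M. norm x \<le> K * sin (\<alpha> x))"
proof
  assume K: "K-lipschitz_on S \<phi>"
  show "\<forall>x\<in>M. norm x \<le> K * sin (\<alpha> x)"
  proof
    fix x assume x: "x \<in> M"
    have "\<forall>\<^sub>F z in at (sgn x) within S. norm (\<phi> z - \<phi> (sgn x)) \<le> K * norm (z - sgn x)"
      unfolding eventually_at_filter
      using lipschitz_on_normD[OF K _ sgn_boundary_in_S[OF x]] by (intro always_eventually) blast
    from rho_le_mult_sin_angle[OF sgn_boundary_in_S[OF x] this] show "norm x \<le> K * sin (\<alpha> x)"
      by (simp add: phi_sgn[OF x])
  qed
next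
  assume "\<forall>x\<in>M. norm x \<le> K * sin (\<alpha> x)"
  then show "K-lipschitz_on S \<phi>"
    by (intro lipschitz_on_phi_of_ae_bound[of "sin a" "{}"] sin_bound_of_tangent_condition[OF tc])
       (auto simp: hausdorff_outer_empty)
qed

lemma lipschitz_of_tangent_condition:
  assumes tc: "tangent_condition a M"
  shows "((SUP x\<in>M. norm x) / sin a)-lipschitz_on S \<phi>"
  unfolding lipschitz_iff_sin_bound[OF tc]
proof
  fix x assume x: "x \<in> M"
  let ?R = "SUP x\<in>M. norm x"
  note s = sin_bound_of_tangent_condition[OF tc x]
  have R: "norm x \<le> ?R" using x by (rule norm_le_SUP)
  then have "0 \<le> ?R" using norm_ge_zero order_trans by blast
  then have "?R / sin a * sin a \<le> ?R / sin a * sin (\<alpha> x)"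
    using s by (intro mult_left_mono) auto
  then show "norm x \<le> ?R / sin a * sin (\<alpha> x)" using R s by simp
qed

lemma bi_lipschitz_of_tangent_condition:
  assumes tc: "tangent_condition a M"
  shows "bi_lipschitz S M \<phi>"
  unfolding bi_lipschitz_def
proof
  show "\<exists>g. homeomorphism S M \<phi> g" using homeomorphism_phi by blast
  obtain K where K: "K-lipschitz_on S \<phi>" using lipschitz_of_tangent_condition[OF tc] by blast
  define L where "L = max 1 (max K (1 / infdist 0 M))"
  have L: "1 \<le> L" "K \<le> L" "1 / infdist 0 M \<le> L" by (auto simp: L_def)
  show "\<exists>L\<ge>1. \<forall>x\<in>S. \<forall>y\<in>S. dist x y / L \<le> dist (\<phi> x) (\<phi> y) \<and> dist (\<phi> x) (\<phi> y) \<le> L * dist x y"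
  proof (intro exI[of _ L] conjI ballI)
    fix x y assume xy: "x \<in> S" "y \<in> S"
    have "1 \<le> L * infdist 0 M" using L(3) infdist_pos by (simp add: field_simps)
    then have "1 * norm (x - y) \<le> (L * infdist 0 M) * norm (x - y)" by (rule mult_right_mono) simp
    also have "\<dots> \<le> L * norm (\<phi> x - \<phi> y)"
      using mult_norm_diff_le[OF xy] L(1) by (simp add: mult.assoc)
    finally show "dist x y / L \<le> dist (\<phi> x) (\<phi> y)" using L(1) by (simp add: dist_norm field_simps)
    show "dist (\<phi> x) (\<phi> y) \<le> L * dist x y"
      using lipschitz_onD[OF lipschitz_on_le[OF K L(2)] xy] .
  qed (fact L(1))
qed

text \<open>The largest constant is the infimum of the tangent angles. A Lipschitz constant \<open>L\<close> forces
  \<open>sin \<alpha>(x) \<ge> dist(M, 0) / L\<close> at every point, which bounds the infimum away from \<open>0\<close> and gives the lower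
  bound on \<open>L\<close>.\<close>

lemma ex_max_tangent_condition:
  assumes K: "K-lipschitz_on S \<phi>"
  shows "\<exists>a. tangent_condition a M \<and> (\<forall>b. tangent_condition b M \<longrightarrow> b \<le> a) \<and>
    (\<forall>L. L-lipschitz_on S \<phi> \<longrightarrow> infdist 0 M / sin a \<le> L)"
proof -
  define a where "a = (INF x\<in>M. \<alpha> x)"
  have bdd: "bdd_below (\<alpha> ` M)" using Liminf_segment_angle(2) by (auto intro!: bdd_belowI2[of _ 0])
  have a_le: "a \<le> \<alpha> x" if "x \<in> M" for x unfolding a_def using that bdd by (intro cINF_lower)
  have le_a: "b \<le> a" if "\<And>x. x \<in> M \<Longrightarrow> b \<le> \<alpha> x" for b
    unfolding a_def using M_nonempty that by (intro cINF_greatest)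
  have lower: "0 < L \<and> infdist 0 M / L \<le> 1 \<and> arcsin (infdist 0 M / L) \<le> a" if L: "L-lipschitz_on S \<phi>" for L
  proof -
    have bound: "norm x \<le> L * sin (\<alpha> x)" if x: "x \<in> M" for x
    proof -
      have "\<forall>\<^sub>F z in at (sgn x) within S. norm (\<phi> z - \<phi> (sgn x)) \<le> L * norm (z - sgn x)"
        unfolding eventually_at_filter
        using lipschitz_on_normD[OF L _ sgn_boundary_in_S[OF x]] by (intro always_eventually) blast
      from rho_le_mult_sin_angle[OF sgn_boundary_in_S[OF x] this] show ?thesis
        by (simp add: phi_sgn[OF x])
    qed
    obtain x0 where x0: "x0 \<in> M" using M_nonempty by blast
    have "0 < L * sin (\<alpha> x0)"
      using bound[OF x0] infdist_le_norm[OF x0] infdist_pos by linarith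
    then have Lpos: "0 < L"
      using sin_angle_nonneg[OF x0] by (simp add: zero_less_mult_iff)
    have ge: "infdist 0 M / L \<le> sin (\<alpha> x)" if "x \<in> M" for x
      using bound[OF that] infdist_le_norm[OF that] Lpos by (simp add: pos_divide_le_eq mult.commute)
    have le1: "infdist 0 M / L \<le> 1" using ge[OF x0] sin_le_one[of "\<alpha> x0"] by linarith
    have pos: "0 < infdist 0 M / L" using infdist_pos Lpos by simp
    have "arcsin (infdist 0 M / L) \<le> a"
    proof (rule le_a)
      fix x assume x: "x \<in> M"
      have "arcsin (infdist 0 M / L) \<le> arcsin (sin (\<alpha> x))"
        using ge[OF x] pos by (intro arcsin_le_arcsin) auto
      also have "\<dots> = \<alpha> x" using Liminf_segment_angle[OF x] by (intro arcsin_sin) auto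
      finally show "arcsin (infdist 0 M / L) \<le> \<alpha> x" .
    qed
    then show ?thesis using Lpos le1 by simp
  qed
  obtain x0 where x0: "x0 \<in> M" using M_nonempty by blast
  have a_le2: "a \<le> pi / 2" using a_le[OF x0] Liminf_segment_angle(3)[OF x0] by linarith
  have "0 < arcsin (infdist 0 M / K)"
    using lower[OF K] infdist_pos arcsin_less_arcsin[of 0 "infdist 0 M / K"] by simp
  then have a_pos: "0 < a" using lower[OF K] by linarith
  show ?thesis
  proof (intro exI[of _ a] conjI allI impI)
    show "tangent_condition a M"
      unfolding tangent_condition_def using a_pos a_le2 a_le by simp
    show "b \<le> a" if "tangent_condition b M" for b
      using that le_a unfolding tangent_condition_def by blast
    show "infdist 0 M / sin a \<le> L" if L: "L-lipschitz_on S \<phi>" for L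
    proof -
      note lo = lower[OF L]
      have pos: "0 < infdist 0 M / L" using infdist_pos lo by simp
      have "sin (arcsin (infdist 0 M / L)) \<le> sin a"
        using lo a_le2 pos arcsin_lbound[of "infdist 0 M / L"] by (intro sin_monotone_2pi_le) auto
      then have "infdist 0 M / L \<le> sin a" using lo pos by simp
      moreover have "0 < sin a" using a_pos a_le2 by (intro sin_gt_zero) auto
      ultimately show ?thesis using lo by (simp add: field_simps)
    qed
  qed
qed

lemma bi_lipschitz_iff_tangent_condition:
  "bi_lipschitz S M \<phi> \<longleftrightarrow> (\<exists>a. tangent_condition a M)"
proof
  assume "bi_lipschitz S M \<phi>"
  then obtain K where "K-lipschitz_on S \<phi>" by (rule lipschitz_on_of_bi_lipschitz)
  from ex_max_tangent_condition[OF this] show "\<exists>a. tangent_condition a M" by blast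
qed (elim exE bi_lipschitz_of_tangent_condition)

lemma Lip_phi_eq_local:
  assumes tc: "tangent_condition a M"
  shows "Lip S \<phi> = (SUP \<zeta>\<in>S. Limsup (at \<zeta> within S) (\<lambda>z. ereal (norm (\<phi> z - \<phi> \<zeta>) / norm (z - \<zeta>))))"
    (is "_ = Sup (?f ` S)")
proof (rule antisym)
  show "Sup (?f ` S) \<le> Lip S \<phi>"
    unfolding Lip_def
  proof (intro Inf_greatest SUP_least, clarify)
    fix u K assume u: "u \<in> S" and K: "K-lipschitz_on S \<phi>"
    show "?f u \<le> ereal K"
    proof (rule Limsup_bounded)
      show "\<forall>\<^sub>F z in at u within S. ereal (norm (\<phi> z - \<phi> u) / norm (z - u)) \<le> ereal K"
        unfolding eventually_at_filter
        using lipschitz_on_normD[OF K _ u] by (intro always_eventually) (simp add: pos_divide_le_eq del: mem_sphere_0)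
    qed
  qed
  show "Lip S \<phi> \<le> Sup (?f ` S)"
  proof (rule ereal_le_real)
    fix K assume K: "Sup (?f ` S) \<le> ereal K"
    have "K-lipschitz_on S \<phi>"
    proof (rule lipschitz_on_of_greater)
      fix L assume L: "K < L"
      show "L-lipschitz_on S \<phi>"
        unfolding lipschitz_iff_sin_bound[OF tc]
      proof
        fix x assume x: "x \<in> M"
        have "?f (sgn x) \<le> Sup (?f ` S)" using sgn_boundary_in_S[OF x] by (rule SUP_upper)
        also have "\<dots> \<le> ereal K" by (rule K)
        also have "\<dots> < ereal L" using L by simp
        finally have "\<forall>\<^sub>F z in at (sgn x) within S. ereal (norm (\<phi> z - \<phi> (sgn x)) / norm (z - sgn x)) < ereal L"
          by (rule Limsup_lessD)
        moreover have "\<forall>\<^sub>F z in at (sgn x) within S. z \<noteq> sgn x" by (simp add: eventually_at_filter)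
        ultimately have "\<forall>\<^sub>F z in at (sgn x) within S. norm (\<phi> z - \<phi> (sgn x)) \<le> L * norm (z - sgn x)"
          by eventually_elim (simp add: pos_divide_less_eq)
        from rho_le_mult_sin_angle[OF sgn_boundary_in_S[OF x] this] show "norm x \<le> L * sin (\<alpha> x)"
          by (simp add: phi_sgn[OF x])
      qed
    qed
    then show "Lip S \<phi> \<le> ereal K" by (rule Lip_le)
  qed
qed

lemma Lip_phi_eq_esssup:
  assumes tc: "tangent_condition a M"
  shows "Lip S \<phi> = esssup (restrict_space (hausdorff_measure (DIM('a) - 1)) M) (\<lambda>x. ereal (norm x / sin (\<alpha> x)))"
    (is "_ = esssup ?H ?f")
proof (rule antisym)
  have M_borel: "M \<in> sets borel" using compact_M by (intro borel_closed compact_imp_closed)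
  have sets_H: "sets ?H = sets (restrict_space borel M)"
    by (rule sets_restrict_space_cong) simp
  have space_H: "space ?H = M" by (simp add: space_restrict_space)
  have f_meas: "?f \<in> borel_measurable ?H"
  proof -
    have "\<alpha> \<in> borel_measurable (restrict_space borel M)"
      using M_borel zero_notin_M by (rule borel_measurable_tangent_angle)
    moreover have "norm \<in> borel_measurable (restrict_space borel M)"
      by (intro measurable_restrict_space1) simp
    ultimately have "?f \<in> borel_measurable (restrict_space borel M)"
      by measurable
    then show ?thesis by (subst measurable_cong_sets[OF sets_H refl])
  qed
  have f_le: "?f x \<le> ereal K \<longleftrightarrow> norm x \<le> K * sin (\<alpha> x)" if "x \<in> M" for x K
    using sin_bound_of_tangent_condition[OF tc that] by (simp add: pos_divide_le_eq less_le_trans[of 0 "sin a"])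
  show "esssup ?H ?f \<le> Lip S \<phi>"
    unfolding Lip_def
  proof (intro Inf_greatest, clarify)
    fix K assume "K-lipschitz_on S \<phi>"
    then have "?f x \<le> ereal K" if "x \<in> M" for x
      unfolding f_le[OF that] using lipschitz_iff_sin_bound[OF tc] that by blast
    then show "esssup ?H ?f \<le> ereal K"
      by (intro esssup_I[OF f_meas] AE_I2) (simp only: space_H)
  qed
  show "Lip S \<phi> \<le> esssup ?H ?f"
  proof (rule ereal_le_real)
    fix K assume K: "esssup ?H ?f \<le> ereal K"
    define N where "N = {x \<in> M. \<not> ?f x \<le> ereal K}"
    have AE: "AE x in ?H. ?f x \<le> ereal K"
    proof (rule eventually_mono)
      show "AE x in ?H. ?f x \<le> esssup ?H ?f" by (rule esssup_AE)
      show "?f x \<le> ereal K" if "?f x \<le> esssup ?H ?f" for x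
        using that K by (rule order_trans)
    qed
    have N_eq: "{x \<in> space ?H. \<not> ?f x \<le> ereal K} = N"
      by (simp only: space_H N_def)
    have N_vimage: "N = ?f -` {ereal K<..} \<inter> space ?H"
      by (auto simp only: N_def space_H not_le vimage_eq greaterThan_iff Int_iff mem_Collect_eq)
    have N_sets: "N \<in> sets ?H"
      unfolding N_vimage by (rule measurable_sets[OF f_meas]) simp
    have "emeasure ?H N = 0"
      using AE_iff_measurable[OF N_sets N_eq] AE by (rule iffD1)
    then have "emeasure (hausdorff_measure (DIM('a) - 1)) N = 0"
      using M_borel by (subst (asm) emeasure_restrict_space) (auto simp: N_def)
    moreover have "N \<in> sets borel"
      using N_sets M_borel unfolding sets_H by (subst (asm) sets_restrict_space_iff) auto
    ultimately have "hausdorff_outer (DIM('a) - 1) N = 0"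
      by (simp add: emeasure_hausdorff_measure)
    then have "K-lipschitz_on S \<phi>"
      using f_le by (intro lipschitz_on_phi_of_ae_bound[of "sin a" N] sin_bound_of_tangent_condition[OF tc])
        (auto simp: N_def)
    then show "Lip S \<phi> \<le> ereal K" by (rule Lip_le)
  qed
qed

end

theorem theorem3p15:
  fixes D M :: "(real ^ 'n) set" and \<phi> :: "real ^ 'n \<Rightarrow> real ^ 'n"
  assumes n: "CARD('n) \<ge> 2"
    and D: "bounded D" "open D" "connected D" "strictly_starlike 0 D"
    and M: "M = frontier D"
    and \<phi>: "\<phi> = radial_map D"
  shows "homeomorphism (sphere 0 1) M \<phi> (inv_into (sphere 0 1) \<phi>) \<and>
         Lip M (inv_into (sphere 0 1) \<phi>) = ereal (1 / infdist 0 M) \<and>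
         ereal (1 / infdist 0 M) =
           Limsup (at_right 0) (\<lambda>r. SUP (z, \<zeta>) \<in> {(z, \<zeta>). z \<in> sphere 0 1 \<and> \<zeta> \<in> sphere 0 1 \<and>
                                                     0 < norm (z - \<zeta>) \<and> norm (z - \<zeta>) < r}.
              ereal (norm (z - \<zeta>) / norm (\<phi> z - \<phi> \<zeta>))) \<and>
         (bi_lipschitz (sphere 0 1) M \<phi> \<longleftrightarrow> (\<exists>\<alpha>. tangent_condition \<alpha> M)) \<and>
         (bi_lipschitz (sphere 0 1) M \<phi> \<longrightarrow>
           (\<exists>\<alpha>. tangent_condition \<alpha> M \<and> (\<forall>\<beta>. tangent_condition \<beta> M \<longrightarrow> \<beta> \<le> \<alpha>) \<and>
             Lip (sphere 0 1) \<phi> =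
               (SUP \<zeta>\<in>sphere 0 1. Limsup (at \<zeta> within sphere 0 1)
                  (\<lambda>z. ereal (norm (\<phi> z - \<phi> \<zeta>) / norm (z - \<zeta>)))) \<and>
             Lip (sphere 0 1) \<phi> =
               esssup (restrict_space (hausdorff_measure (CARD('n) - 1)) M)
                  (\<lambda>x. ereal (norm x / sin (tangent_angle M x))) \<and>
             Lip (sphere 0 1) \<phi> \<in>
               {ereal ((INF x\<in>M. norm x) / sin \<alpha>) .. ereal ((SUP x\<in>M. norm x) / sin \<alpha>)}))"
proof -
  interpret starlike_domain D
    by (unfold_locales, fact D(1), fact D(2), fact D(4)) (use n in simp)
  show ?thesis
    unfolding M \<phi>
  proof (intro conjI impI)
    assume "bi_lipschitz (sphere 0 1) (frontier D) (radial_map D)"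
    then obtain K where "K-lipschitz_on (sphere 0 1) (radial_map D)"
      by (rule lipschitz_on_of_bi_lipschitz)
    from ex_max_tangent_condition[OF this] obtain a where tc: "tangent_condition a (frontier D)"
      and max: "\<And>b. tangent_condition b (frontier D) \<Longrightarrow> b \<le> a"
      and lower: "\<And>L. L-lipschitz_on (sphere 0 1) (radial_map D) \<Longrightarrow> infdist 0 (frontier D) / sin a \<le> L"
      by blast
    have "ereal ((INF x\<in>frontier D. norm x) / sin a) \<le> Lip (sphere 0 1) (radial_map D)"
      unfolding Lip_def infdist_eq_INF[symmetric] using lower by (intro Inf_greatest) auto
    moreover have "Lip (sphere 0 1) (radial_map D) \<le> ereal ((SUP x\<in>frontier D. norm x) / sin a)"
      by (rule Lip_le[OF lipschitz_of_tangent_condition[OF tc]])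
    ultimately have range: "Lip (sphere 0 1) (radial_map D) \<in>
         {ereal ((INF x\<in>frontier D. norm x) / sin a) .. ereal ((SUP x\<in>frontier D. norm x) / sin a)}"
      by (simp only: atLeastAtMost_iff)
    have "DIM(real ^ 'n) = CARD('n)" by simp
    note esssup = Lip_phi_eq_esssup[OF tc, unfolded this]
    show "\<exists>a. tangent_condition a (frontier D) \<and> (\<forall>b. tangent_condition b (frontier D) \<longrightarrow> b \<le> a) \<and>
       Lip (sphere 0 1) (radial_map D) =
         (SUP \<zeta>\<in>sphere 0 1. Limsup (at \<zeta> within sphere 0 1)
            (\<lambda>z. ereal (norm (radial_map D z - radial_map D \<zeta>) / norm (z - \<zeta>)))) \<and>
       Lip (sphere 0 1) (radial_map D) =
         esssup (restrict_space (hausdorff_measure (CARD('n) - 1)) (frontier D))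
            (\<lambda>x. ereal (norm x / sin (tangent_angle (frontier D) x))) \<and>
       Lip (sphere 0 1) (radial_map D) \<in>
         {ereal ((INF x\<in>frontier D. norm x) / sin a) .. ereal ((SUP x\<in>frontier D. norm x) / sin a)}"
      by (rule exI[of _ a], intro conjI allI impI)
         (fact tc, erule max, fact Lip_phi_eq_local[OF tc], fact esssup, fact range)
  qed (fact homeomorphism_inv_into Lip_inverse Limsup_ratio_inverse bi_lipschitz_iff_tangent_condition)+
qed

end
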